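(* Let $\pi^*_\alpha$ be the Nash equilibrium of the regularized preference model $\mathcal P_\alpha$, and let $(\pi_t)_{t\ge 1}$ be the policies produced by MTPO with learning rates $\eta_t=\frac{2}{\alpha(t+2)}$. Let $\mathbb Q$ be a bound on the magnitude of the Q-functions, i.e. $|Q_\alpha^{\pi_t,\pi_t}(x,y)|\le \mathbb Q$ for all $t\ge 1$, all non-terminal states $x$ and all $y\in\mathcal Y$. Then for every iteration $t\ge 1$, $$\mathrm{KL}_p(\pi^*_\alpha\,\|\,\pi_t)\le \frac{32\,H\,\mathbb Q^2}{\alpha^2(t+1)}.$$ Moreover, if $\mu_{\min}=\min\{\mu(y\mid x): \mu(y\mid x)>0\}$ is the minimal non-zero probability assigned by $\mu$, then the magnitude bound can be taken to satisfy $\mathbb Q\le \max\{4\alpha H\log\frac{1}{\mu_{\min}},\,1\}$, i.e. $\sup_{t,x,y}|Q_\alpha^{\pi_t,\pi_t}(x,y)|\le \max\{4\alpha H\log\frac1{\mu_{\min}},1\}$.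
   Context: MDP. Fix a finite-horizon MDP with horizon $H\ge1$, finite state space $\mathcal X=\bigsqcup_{h=1}^{H+1}\mathcal X_h$ (disjoint union), finite action space $\mathcal Y$, initial state $x_1\in\mathcal X_1$, and transition function $p$, where for $x_h\in\mathcal X_h$ ($h\le H$) and $y_h\in\mathcal Y$, $p(\cdot\mid x_h,y_h)$ is a probability distribution on $\mathcal X_{h+1}$. A policy $\pi$ assigns to each non-terminal state $x$ (i.e. $x\in\mathcal X_h$, $h\le H$) a probability distribution $\pi(\cdot\mid x)$ on $\mathcal Y$. $\Pr_{\pi,p},\mathbb E_{\pi,p}$ refer to the random trajectory $(x_1,y_1,\dots,x_H,y_H,x_{H+1})$ with $y_h\sim\pi(\cdot\mid x_h)$, $x_{h+1}\sim p(\cdot\mid x_h,y_h)$; conditioning on $x_h$ (resp. $x_h,y_h$) means the trajectory is started at $x_h$ (resp. at $x_h$ with action $y_h$) and continued with $\pi,p$. KL. $\mathrm{KL}(\pi\|\pi')[x]=\sum_{y}\pi(y\mid x)\log\frac{\pi(y\mid x)}{\pi'(y\mid x)}$. $\mathrm{KL}_p(\pi\|\pi')$ is the KL divergence between the distributions over trajectories induced by $\pi$ and by $\pi'$ (with the same $p$). Preferences. $\mathcal P(x\succ x')\in[0,1]$ is given for $x,x'\in\mathcal X_{H+1}$, with $\mathcal P(x'\succ x)=1-\mathcal P(x\succ x')$. For policies, $\mathcal P(x\succ\pi')=\mathbb E_{\pi',p}[\mathcal P(x\succ x_{H+1})]$ and $\mathcal P(\pi\succ\pi')=\mathbb E_{\pi,p}[\mathcal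 P(x_{H+1}\succ\pi')]$. Fix a reference policy $\mu$ and $\alpha>0$. All policies considered satisfy $\pi(y\mid x)=0$ whenever $\mu(y\mid x)=0$. The regularized preference model is $\mathcal P_\alpha(\pi\succ\pi')=\mathcal P(\pi\succ\pi')-\alpha\,\mathrm{KL}_p(\pi\|\mu)+\alpha\,\mathrm{KL}_p(\pi'\|\mu)$. A policy $\pi^*$ is a Nash equilibrium of $\mathcal P_\alpha$ if $\mathcal P_\alpha(\pi\succ\pi^* )\le\mathcal P_\alpha(\pi^*\succ\pi^* )\le\mathcal P_\alpha(\pi^*\succ\pi)$ for all policies $\pi$; it is unique up to its values at states not reachable under $\mu$. Q-function. $Q_\alpha^{\pi,\pi'}(x_h,y_h)=\mathbb E_{\pi,p}\big[\mathcal P(x_{H+1}\succ\pi')-\alpha\sum_{h'=h}^H\mathrm{KL}(\pi\|\mu)[x_{h'}]\,\big|\,x_h,y_h\big]$. MTPO. $\pi_1=\mu$ and, for $t\ge1$ and every non-terminal state $x$, $$\pi_{t+1}(\cdot\mid x)=\arg\max_{\pi(\cdot\mid x)}\ \eta_t\sum_y\pi(y\mid x)Q_\alpha^{\pi_t,\pi_t}(x,y)-\alpha\eta_t\mathrm{KL}(\pi\|\mu)[x]-(1-\alpha\eta_t)\mathrm{KL}(\pi\|\pi_t)[x],$$ equivalently $\pi_{t+1}(y\mid x)\propto\mu(y\mid x)^{\alpha\eta_t}\pi_t(y\mid x)^{1-\alpha\eta_t}e^{\eta_tQ_\alpha^{\pi_t,\pi_t}(x,y)}$. *)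

theory Defs
  imports "HOL-Probability.Probability"
begin

text \<open>
  A finite-horizon MDP with state type \<open>'x\<close> and action type \<open>'y\<close>, together with a preference
  function on terminal states.  Only \<open>layer M h\<close> for \<open>1 \<le> h \<le> H + 1\<close>, \<open>transition M x y\<close> for
  non-terminal \<open>x\<close> and \<open>pref M x x'\<close> for terminal \<open>x\<close>, \<open>x'\<close> are meaningful;
  \<open>pref M x x'\<close> is the probability that \<open>x\<close> is preferred to \<open>x'\<close>.
\<close>

record ('x, 'y) pref_mdp =
  horizon :: nat
  layer :: "nat \<Rightarrow> 'x set"
  init_state :: 'x
  transition :: "'x \<Rightarrow> 'y \<Rightarrow> 'x pmf"
  pref :: "'x \<Rightarrow> 'x \<Rightarrow> real"

locale pref_mdp =
  fixes M :: "('x::finite, 'y::finite) pref_mdp"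
  assumes horizon_ge_1: "horizon M \<ge> 1"
    and layers_cover: "(\<Union>h\<in>{1..horizon M + 1}. layer M h) = UNIV"
    and layers_disjoint: "disjoint_family_on (layer M) {1..horizon M + 1}"
    and init_in: "init_state M \<in> layer M 1"
    and trans_layer: "\<And>h x y. h \<in> {1..horizon M} \<Longrightarrow> x \<in> layer M h \<Longrightarrow>
      set_pmf (transition M x y) \<subseteq> layer M (h + 1)"
    and pref_range: "\<And>x x'. x \<in> layer M (horizon M + 1) \<Longrightarrow> x' \<in> layer M (horizon M + 1) \<Longrightarrow>
      pref M x x' \<in> {0..1}"
    and pref_compl: "\<And>x x'. x \<in> layer M (horizon M + 1) \<Longrightarrow> x' \<in> layer M (horizon M + 1) \<Longrightarrow>
      pref M x' x = 1 - pref M x x'"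

definition nonterm_states :: "('x, 'y) pref_mdp \<Rightarrow> 'x set" where
  "nonterm_states M = (\<Union>h\<in>{1..horizon M}. layer M h)"

text \<open>The values of a policy at terminal states are never used.\<close>

type_synonym ('x, 'y) policy = "'x \<Rightarrow> 'y pmf"

text \<open>
  The trajectory \<open>(x\<^sub>h, y\<^sub>h, \<dots>, x\<^sub>H, y\<^sub>H, x\<^bsub>H+1\<^esub>)\<close> is encoded as the list of pairs
  \<open>(x\<^sub>h, y\<^sub>h), \<dots>, (x\<^sub>H, y\<^sub>H)\<close> together with the final state \<open>x\<^bsub>H+1\<^esub>\<close>.
\<close>

type_synonym ('x, 'y) traj = "('x \<times> 'y) list \<times> 'x"

text \<open>\<open>traj_from M \<pi> n x\<close>: run \<open>n\<close> steps, starting at \<open>x\<close>.\<close>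

primrec traj_from :: "('x, 'y) pref_mdp \<Rightarrow> ('x, 'y) policy \<Rightarrow> nat \<Rightarrow> 'x \<Rightarrow> ('x, 'y) traj pmf" where
  "traj_from M \<pi> 0 x = return_pmf ([], x)"
| "traj_from M \<pi> (Suc n) x =
     bind_pmf (\<pi> x) (\<lambda>y. bind_pmf (transition M x y) (\<lambda>x'.
       map_pmf (\<lambda>(l, z). ((x, y) # l, z)) (traj_from M \<pi> n x')))"

text \<open>\<open>traj_from_act M \<pi> n x y\<close>: start at \<open>x\<close> with action \<open>y\<close>, then run \<open>n\<close> further steps.\<close>

definition traj_from_act ::
    "('x, 'y) pref_mdp \<Rightarrow> ('x, 'y) policy \<Rightarrow> nat \<Rightarrow> 'x \<Rightarrow> 'y \<Rightarrow> ('x, 'y) traj pmf" where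
  "traj_from_act M \<pi> n x y =
     bind_pmf (transition M x y) (\<lambda>x'.
       map_pmf (\<lambda>(l, z). ((x, y) # l, z)) (traj_from M \<pi> n x'))"

definition traj_pmf :: "('x, 'y) pref_mdp \<Rightarrow> ('x, 'y) policy \<Rightarrow> ('x, 'y) traj pmf" where
  "traj_pmf M \<pi> = traj_from M \<pi> (horizon M) (init_state M)"

text \<open>
  \<open>KL(q \<parallel> q')\<close> on the finite action space.  Summands with \<open>q(y) = 0\<close> vanish, as usual.  Summands
  with \<open>q(y) > 0 = q'(y)\<close> also vanish (instead of being infinite), so the formula is the usual
  divergence only if \<open>q\<close> is absolutely continuous with respect to \<open>q'\<close>.
\<close>

definition KL_act :: "'y::finite pmf \<Rightarrow> 'y pmf \<Rightarrow> real" where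
  "KL_act q q' = (\<Sum>y\<in>UNIV. pmf q y * ln (pmf q y / pmf q' y))"

text \<open>
  \<open>KL\<^sub>p(\<pi> \<parallel> \<pi>')\<close>.  In the library, \<open>KL_divergence b M N\<close> is the divergence of \<open>N\<close> from the base
  measure \<open>M\<close>, hence the order of the arguments.
\<close>

definition KL_traj :: "('x, 'y) pref_mdp \<Rightarrow> ('x, 'y) policy \<Rightarrow> ('x, 'y) policy \<Rightarrow> real" where
  "KL_traj M \<pi> \<pi>' =
     KL_divergence (exp 1) (measure_pmf (traj_pmf M \<pi>')) (measure_pmf (traj_pmf M \<pi>))"

definition pref_state_policy :: "('x, 'y) pref_mdp \<Rightarrow> 'x \<Rightarrow> ('x, 'y) policy \<Rightarrow> real" where
  "pref_state_policy M x \<pi>' =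
     measure_pmf.expectation (traj_pmf M \<pi>') (\<lambda>(l, z). pref M x z)"

definition pref_policy :: "('x, 'y) pref_mdp \<Rightarrow> ('x, 'y) policy \<Rightarrow> ('x, 'y) policy \<Rightarrow> real" where
  "pref_policy M \<pi> \<pi>' =
     measure_pmf.expectation (traj_pmf M \<pi>) (\<lambda>(l, z). pref_state_policy M z \<pi>')"

definition admissible :: "('x, 'y) pref_mdp \<Rightarrow> ('x, 'y) policy \<Rightarrow> ('x, 'y) policy \<Rightarrow> bool" where
  "admissible M \<mu> \<pi> \<longleftrightarrow>
     (\<forall>x\<in>nonterm_states M. \<forall>y. pmf (\<mu> x) y = 0 \<longrightarrow> pmf (\<pi> x) y = 0)"

definition reg_pref ::
    "('x, 'y) pref_mdp \<Rightarrow> ('x, 'y) policy \<Rightarrow> real \<Rightarrow> ('x, 'y) policy \<Rightarrow> ('x, 'y) policy \<Rightarrow> real" where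
  "reg_pref M \<mu> \<alpha> \<pi> \<pi>' = pref_policy M \<pi> \<pi>' - \<alpha> * KL_traj M \<pi> \<mu> + \<alpha> * KL_traj M \<pi>' \<mu>"

definition is_nash ::
    "('x, 'y) pref_mdp \<Rightarrow> ('x, 'y) policy \<Rightarrow> real \<Rightarrow> ('x, 'y) policy \<Rightarrow> bool" where
  "is_nash M \<mu> \<alpha> \<pi>s \<longleftrightarrow> admissible M \<mu> \<pi>s \<and>
     (\<forall>\<pi>. admissible M \<mu> \<pi> \<longrightarrow>
        reg_pref M \<mu> \<alpha> \<pi> \<pi>s \<le> reg_pref M \<mu> \<alpha> \<pi>s \<pi>s \<and>
        reg_pref M \<mu> \<alpha> \<pi>s \<pi>s \<le> reg_pref M \<mu> \<alpha> \<pi>s \<pi>)"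

text \<open>
  The regularized Q-function at a state \<open>x\<close> of layer \<open>h\<close>.  The state \<open>x\<^bsub>h'\<^esub>\<close> of a trajectory
  started in layer \<open>h\<close> sits at position \<open>h' - h\<close> of its list.
\<close>

definition Q_fun ::
    "('x, 'y::finite) pref_mdp \<Rightarrow> ('x, 'y) policy \<Rightarrow> real \<Rightarrow> ('x, 'y) policy \<Rightarrow> ('x, 'y) policy
      \<Rightarrow> nat \<Rightarrow> 'x \<Rightarrow> 'y \<Rightarrow> real" where
  "Q_fun M \<mu> \<alpha> \<pi> \<pi>' h x y =
     measure_pmf.expectation (traj_from_act M \<pi> (horizon M - h) x y)
       (\<lambda>(l, z). pref_state_policy M z \<pi>'
          - \<alpha> * (\<Sum>h'=h..horizon M. KL_act (\<pi> (fst (l ! (h' - h)))) (\<mu> (fst (l ! (h' - h))))))"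

text \<open>
  \<open>\<pi> 1, \<pi> 2, \<dots>\<close> are iterates of MTPO with learning rates \<open>\<eta> 1, \<eta> 2, \<dots>\<close>; the value \<open>\<pi> 0\<close> is
  irrelevant.  The maximization at \<open>x\<close> is over the action distributions \<open>q\<close> that an admissible
  policy may use at \<open>x\<close>.
\<close>

definition mtpo_objective ::
    "('x, 'y::finite) pref_mdp \<Rightarrow> ('x, 'y) policy \<Rightarrow> real \<Rightarrow> real \<Rightarrow> ('x, 'y) policy
      \<Rightarrow> nat \<Rightarrow> 'x \<Rightarrow> 'y pmf \<Rightarrow> real" where
  "mtpo_objective M \<mu> \<alpha> \<eta> \<pi> h x q =
     \<eta> * (\<Sum>y\<in>UNIV. pmf q y * Q_fun M \<mu> \<alpha> \<pi> \<pi> h x y)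
       - \<alpha> * \<eta> * KL_act q (\<mu> x) - (1 - \<alpha> * \<eta>) * KL_act q (\<pi> x)"

definition is_mtpo ::
    "('x, 'y::finite) pref_mdp \<Rightarrow> ('x, 'y) policy \<Rightarrow> real \<Rightarrow> (nat \<Rightarrow> real)
      \<Rightarrow> (nat \<Rightarrow> ('x, 'y) policy) \<Rightarrow> bool" where
  "is_mtpo M \<mu> \<alpha> \<eta> \<pi> \<longleftrightarrow>
     (\<forall>x\<in>nonterm_states M. \<pi> 1 x = \<mu> x) \<and>
     (\<forall>t\<ge>1. \<forall>h\<in>{1..horizon M}. \<forall>x\<in>layer M h.
        is_arg_max (mtpo_objective M \<mu> \<alpha> (\<eta> t) (\<pi> t) h x)
          (\<lambda>q. \<forall>y. pmf (\<mu> x) y = 0 \<longrightarrow> pmf q y = 0) (\<pi> (t + 1) x))"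

definition min_prob :: "('x, 'y) pref_mdp \<Rightarrow> ('x, 'y) policy \<Rightarrow> real" where
  "min_prob M \<mu> = Min {pmf (\<mu> x) y | x y. x \<in> nonterm_states M \<and> pmf (\<mu> x) y > 0}"

end

(*
  For a fixed comparator s, the MTPO update at a state x is a mirror descent step; if Q_t is
  bounded by B, then alpha ln(pi_t / mu) stays, up to an additive constant depending on x and t,
  within B, because it is a weighted average of the earlier Q-functions.  Hoeffding's lemma applied
  to the normalising constant therefore gives
    KL(s || pi_(t+1))[x] <= (1 - alpha eta_t) KL(s || pi_t)[x]
      + eta_t (<pi_t - s, Q_t>[x] + alpha KL(s || mu)[x] - alpha KL(pi_t || mu)[x]) + 2 eta_t^2 B^2.
  Averaged over the trajectories of the Nash equilibrium s, the bracket sums to the difference of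
  the regularized values of pi_t and s against pi_t, which is nonpositive.  The resulting recursion
  yields the rate 1/t.  It starts from KL_p(s || mu) <= H / (2 alpha^2), which again follows from
  Hoeffding's lemma and the equilibrium property, and from B >= 1/2.
*)
theory Submission
  imports Defs
begin

section \<open>Entropy inequalities\<close>

text \<open>Gibbs' inequality against an unnormalised weight, so that one statement covers
  probability distributions, exponential tilts and mirror descent weights. The equality case later
  identifies the maximiser of the MTPO objective.\<close>

lemma gibbs:
  fixes q :: "'y::finite pmf" and w :: "'y \<Rightarrow> real"
  assumes nonneg: "\<And>y. w y \<ge> 0" and supp: "\<And>y. pmf q y > 0 \<Longrightarrow> w y > 0"
  defines "Z \<equiv> \<Sum>y\<in>UNIV. w y"
  shows gibbs_pos: "Z > 0"
    and gibbs_ineq: "- ln Z \<le> (\<Sum>y\<in>UNIV. pmf q y * ln (pmf q y / w y))"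
    and gibbs_eq: "(\<Sum>y\<in>UNIV. pmf q y * ln (pmf q y / w y)) \<le> - ln Z \<Longrightarrow> pmf q y = w y / Z"
proof -
  have sum_q: "(\<Sum>y\<in>UNIV. pmf q y) = 1"
    by (rule sum_pmf_eq_1) auto
  obtain y0 where "pmf q y0 > 0"
    using sum_q by (metis pmf_nonneg less_eq_real_def sum.neutral zero_neq_one)
  then have "w y0 > 0" by (rule supp)
  then show Z: "Z > 0"
    unfolding Z_def by (intro sum_pos2[of _ y0]) (auto simp: nonneg)
  \<comment> \<open>The terms \<open>w y / Z - pmf q y\<close> sum to zero and make every summand
    nonnegative by \<open>ln z \<le> z - 1\<close>, so a vanishing total forces equality at each
    \<open>y\<close>.\<close>
  define d where "d y = w y / Z - pmf q y + pmf q y * (ln (pmf q y / w y) + ln Z)" for y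
  have eq: "ln (pmf q y / w y) + ln Z = - ln (w y / (pmf q y * Z))" if "pmf q y > 0" for y
    using that supp[OF that] Z by (simp add: ln_div ln_mult)
  have d_alt: "d y = pmf q y * (w y / (pmf q y * Z) - 1 - ln (w y / (pmf q y * Z)))"
    if "pmf q y > 0" for y
    unfolding d_def eq[OF that] using that Z by (simp add: field_simps)
  have d_nonneg: "d y \<ge> 0" for y
  proof (cases "pmf q y > 0")
    case True
    then have "ln (w y / (pmf q y * Z)) \<le> w y / (pmf q y * Z) - 1"
      using supp[OF True] Z by (intro ln_le_minus_one) simp
    then show ?thesis using True by (simp add: d_alt)
  next
    case False
    then have "pmf q y = 0" by (simp add: order.antisym not_less)
    then show ?thesis using nonneg[of y] Z by (simp add: d_def)
  qed
  have d_sum: "(\<Sum>y\<in>UNIV. d y) = (\<Sum>y\<in>UNIV. pmf q y * ln (pmf q y / w y)) + ln Z"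
  proof -
    have "(\<Sum>y\<in>UNIV. d y) = (\<Sum>y\<in>UNIV. w y) / Z - (\<Sum>y\<in>UNIV. pmf q y)
        + ((\<Sum>y\<in>UNIV. pmf q y * ln (pmf q y / w y)) + (\<Sum>y\<in>UNIV. pmf q y) * ln Z)"
      by (simp add: d_def sum.distrib sum_subtractf distrib_left sum_distrib_right sum_divide_distrib)
    then show ?thesis using Z by (simp add: sum_q Z_def[symmetric])
  qed
  have "(\<Sum>y\<in>UNIV. d y) \<ge> 0" by (simp add: sum_nonneg d_nonneg)
  then show "- ln Z \<le> (\<Sum>y\<in>UNIV. pmf q y * ln (pmf q y / w y))"
    using d_sum by simp
  show "pmf q y = w y / Z" if "(\<Sum>y\<in>UNIV. pmf q y * ln (pmf q y / w y)) \<le> - ln Z"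
  proof -
    have "(\<Sum>y\<in>UNIV. d y) = 0" using that d_sum \<open>(\<Sum>y\<in>UNIV. d y) \<ge> 0\<close> by simp
    then have d0: "d y = 0" by (simp add: sum_nonneg_eq_0_iff d_nonneg)
    show ?thesis
    proof (cases "pmf q y > 0")
      case True
      then have "ln (w y / (pmf q y * Z)) = w y / (pmf q y * Z) - 1"
        using d0 by (simp add: d_alt)
      then have "w y / (pmf q y * Z) = 1"
        using True supp[OF True] Z by (intro ln_eq_minus_one) simp_all
      then show ?thesis using True Z by (simp add: field_simps)
    next
      case False
      then have "pmf q y = 0" by (simp add: order.antisym not_less)
      then show ?thesis using d0 Z by (simp add: d_def)
    qed
  qed
qed

lemma KL_act_nonneg:
  assumes "\<And>y. pmf q y > 0 \<Longrightarrow> pmf p y > 0"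
  shows "KL_act q p \<ge> 0"
proof -
  have "(\<Sum>y\<in>UNIV. pmf p y) = 1" by (rule sum_pmf_eq_1) auto
  then show ?thesis
    using gibbs_ineq[of "pmf p" q] assms by (simp add: KL_act_def)
qed

text \<open>Donsker-Varadhan inequality: Gibbs' inequality against the tilted weight
  \<open>pmf p y * exp (f y)\<close>.\<close>

lemma variational_KL_act:
  assumes "\<And>y. pmf q y > 0 \<Longrightarrow> pmf p y > 0"
  shows "(\<Sum>y\<in>UNIV. pmf q y * f y) \<le> KL_act q p + ln (\<Sum>y\<in>UNIV. pmf p y * exp (f y))"
proof -
  have "- ln (\<Sum>y\<in>UNIV. pmf p y * exp (f y))
      \<le> (\<Sum>y\<in>UNIV. pmf q y * ln (pmf q y / (pmf p y * exp (f y))))"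
    by (rule gibbs_ineq) (auto simp: assms)
  also have "\<dots> = (\<Sum>y\<in>UNIV. pmf q y * ln (pmf q y / pmf p y) - pmf q y * f y)"
  proof (rule sum.cong[OF refl])
    fix y
    show "pmf q y * ln (pmf q y / (pmf p y * exp (f y)))
        = pmf q y * ln (pmf q y / pmf p y) - pmf q y * f y"
    proof (cases "pmf q y = 0")
      case False
      then have "pmf q y > 0" by (simp add: order_less_le)
      with assms[OF this] show ?thesis by (simp add: ln_div ln_mult algebra_simps)
    qed simp
  qed
  finally show ?thesis by (simp add: KL_act_def sum_subtractf)
qed

text \<open>Hoeffding's lemma bounds the exponential moment of the centred variable; the mean enters
  through the factor \<open>exp (l * m)\<close>.\<close>

lemma ln_expectation_exp_le:
  fixes p :: "'y::finite pmf"
  assumes "\<And>y. pmf p y > 0 \<Longrightarrow> f y \<in> {a..b}" and l: "l > 0"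
  shows "ln (\<Sum>y\<in>UNIV. pmf p y * exp (l * f y))
    \<le> l * (\<Sum>y\<in>UNIV. pmf p y * f y) + l\<^sup>2 * (b - a)\<^sup>2 / 8"
proof -
  interpret interval_bounded_random_variable "measure_pmf p" f a b
    by unfold_locales (use assms(1) in \<open>auto simp: AE_measure_pmf_iff set_pmf_iff pmf_pos\<close>)
  define m where "m = (\<Sum>y\<in>UNIV. pmf p y * f y)"
  have E: "measure_pmf.expectation p h = (\<Sum>y\<in>UNIV. pmf p y * h y)" for h :: "'y \<Rightarrow> real"
    by (subst integral_measure_pmf[of UNIV]) auto
  have m: "measure_pmf.expectation p f = m" by (simp add: E m_def)
  have "ennreal (\<Sum>y\<in>UNIV. pmf p y * exp (l * (f y - m)))
      = nn_integral (measure_pmf p) (\<lambda>y. exp (l * (f y - m)))"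
    by (subst nn_integral_eq_integral) (auto simp: E intro!: integrable_measure_pmf_finite)
  also have "\<dots> \<le> ennreal (exp (l\<^sup>2 * (b - a)\<^sup>2 / 8))"
    using Hoeffdings_lemma_nn_integral[OF l] by (simp add: m)
  finally have le: "(\<Sum>y\<in>UNIV. pmf p y * exp (l * (f y - m))) \<le> exp (l\<^sup>2 * (b - a)\<^sup>2 / 8)"
    by simp
  have "(\<Sum>y\<in>UNIV. pmf p y * exp (l * f y))
      = exp (l * m) * (\<Sum>y\<in>UNIV. pmf p y * exp (l * (f y - m)))"
    by (simp add: sum_distrib_left exp_diff right_diff_distrib)
  also have "\<dots> \<le> exp (l * m) * exp (l\<^sup>2 * (b - a)\<^sup>2 / 8)"
    using le by (intro mult_left_mono) auto
  finally have "(\<Sum>y\<in>UNIV. pmf p y * exp (l * f y)) \<le> exp (l * m + l\<^sup>2 * (b - a)\<^sup>2 / 8)"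
    by (simp add: exp_add)
  moreover have "(\<Sum>y\<in>UNIV. pmf p y * exp (l * f y)) > 0"
    by (rule gibbs_pos[of _ p]) auto
  ultimately have "ln (\<Sum>y\<in>UNIV. pmf p y * exp (l * f y)) \<le> l * m + l\<^sup>2 * (b - a)\<^sup>2 / 8"
    by (metis exp_gt_zero ln_exp ln_le_cancel_iff)
  then show ?thesis by (simp add: m_def)
qed

text \<open>Absolute continuity makes the quotient of point masses a density of \<open>P\<close>
  with respect to \<open>Q\<close>, and uniqueness identifies it with the Radon-Nikodym
  derivative.\<close>

lemma KL_divergence_pmf:
  assumes "set_pmf P \<subseteq> set_pmf Q"
  shows "KL_divergence (exp 1) (measure_pmf Q) (measure_pmf P)
    = measure_pmf.expectation P (\<lambda>x. ln (pmf P x / pmf Q x))"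
proof -
  have dens: "density (measure_pmf Q) (\<lambda>x. ennreal (pmf P x / pmf Q x)) = measure_pmf P"
  proof -
    have "density (measure_pmf Q) (\<lambda>x. ennreal (pmf P x / pmf Q x))
        = density (count_space UNIV) (\<lambda>x. ennreal (pmf Q x) * ennreal (pmf P x / pmf Q x))"
      unfolding measure_pmf_eq_density[of Q] by (subst density_density_eq) auto
    also have "\<dots> = density (count_space UNIV) (\<lambda>x. ennreal (pmf P x))"
    proof (intro density_cong AE_I2)
      fix x show "ennreal (pmf Q x) * ennreal (pmf P x / pmf Q x) = ennreal (pmf P x)"
        using assms by (cases "pmf Q x = 0") (auto simp: ennreal_mult'[symmetric] set_pmf_iff)
    qed auto
    finally show ?thesis by (simp add: measure_pmf_eq_density)
  qed
  have "AE x in measure_pmf Q. ennreal (pmf P x / pmf Q x) = RN_deriv (measure_pmf Q) (measure_pmf P) x"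
    by (rule measure_pmf.RN_deriv_unique) (auto simp: dens)
  then have "entropy_density (exp 1) (measure_pmf Q) (measure_pmf P) x = ln (pmf P x / pmf Q x)"
    if "x \<in> set_pmf P" for x
    using that assms
    by (auto simp: AE_measure_pmf_iff entropy_density_def log_ln[symmetric] dest!: bspec[of _ _ x])
       (metis enn2real_ennreal divide_nonneg_nonneg pmf_nonneg)
  then show ?thesis
    unfolding KL_divergence_def by (intro integral_cong_AE) (auto simp: AE_measure_pmf_iff)
qed

section \<open>Values along trajectories\<close>

text \<open>Expected total reward with running reward \<open>r\<close> and terminal reward
  \<open>g\<close>. Win probabilities, trajectory divergences and regularised values all have this
  form and so share one backward recursion.\<close>

definition traj_value ::
    "('x, 'y) pref_mdp \<Rightarrow> ('x, 'y) policy \<Rightarrow> ('x \<Rightarrow> 'y \<Rightarrow> real) \<Rightarrow> ('x \<Rightarrow> real) \<Rightarrow> nat \<Rightarrow> 'x \<Rightarrow> real"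
  where "traj_value M \<pi> r g n x =
    measure_pmf.expectation (traj_from M \<pi> n x) (\<lambda>(l, z). g z + (\<Sum>(x, y)\<leftarrow>l. r x y))"

definition trans_expect :: "('x::finite, 'y) pref_mdp \<Rightarrow> 'x \<Rightarrow> 'y \<Rightarrow> ('x \<Rightarrow> real) \<Rightarrow> real" where
  "trans_expect M x y f = (\<Sum>x'\<in>UNIV. pmf (transition M x y) x' * f x')"

lemma trans_expect_add: "trans_expect M x y (\<lambda>x. f x + g x) = trans_expect M x y f + trans_expect M x y g"
  by (simp add: trans_expect_def distrib_left sum.distrib)

lemma trans_expect_diff: "trans_expect M x y (\<lambda>x. f x - g x) = trans_expect M x y f - trans_expect M x y g"
  by (simp add: trans_expect_def right_diff_distrib sum_subtractf)

lemma trans_expect_mult: "trans_expect M x y (\<lambda>x. c * f x) = c * trans_expect M x y f"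
  by (simp add: trans_expect_def sum_distrib_left algebra_simps)

lemma trans_expect_const: "trans_expect M x y (\<lambda>_. c) = c"
proof -
  have "(\<Sum>x'\<in>UNIV. pmf (transition M x y) x') = 1" by (rule sum_pmf_eq_1) auto
  then show ?thesis by (simp add: trans_expect_def flip: sum_distrib_right)
qed

lemma trans_expect_mono:
  assumes "\<And>x'. x' \<in> set_pmf (transition M x y) \<Longrightarrow> f x' \<le> g x'"
  shows "trans_expect M x y f \<le> trans_expect M x y g"
  unfolding trans_expect_def
proof (rule sum_mono)
  fix x'
  show "pmf (transition M x y) x' * f x' \<le> pmf (transition M x y) x' * g x'"
    using assms[of x'] by (cases "pmf (transition M x y) x' = 0") (auto simp: set_pmf_iff mult_left_mono)
qed

section \<open>Finiteness of trajectory laws and Bellman recursions\<close>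

lemma finite_set_traj_from [simp]:
  fixes M :: "('x::finite, 'y::finite) pref_mdp"
  shows "finite (set_pmf (traj_from M \<pi> n x))"
  by (induction n arbitrary: x) (auto simp: set_map_pmf)

lemma finite_set_traj_from_act [simp]:
  fixes M :: "('x::finite, 'y::finite) pref_mdp"
  shows "finite (set_pmf (traj_from_act M \<pi> n x y))"
  by (auto simp: traj_from_act_def)

lemma traj_from_Suc: "traj_from M \<pi> (Suc n) x = bind_pmf (\<pi> x) (traj_from_act M \<pi> n x)"
  by (simp add: traj_from_act_def[abs_def])

lemma length_traj_from: "(l, z) \<in> set_pmf (traj_from M \<pi> n x) \<Longrightarrow> length l = n"
  by (induction n arbitrary: x l) auto

lemma traj_value_0 [simp]: "traj_value M \<pi> r g 0 x = g x"
  by (simp add: traj_value_def)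

text \<open>The list begins with the fixed pair \<open>(x, y)\<close>, whose reward is a constant,
  and the rest restarts at the next state: the Bellman equation for a fixed action.\<close>

lemma expectation_traj_from_act:
  fixes M :: "('x::finite, 'y::finite) pref_mdp"
  shows "measure_pmf.expectation (traj_from_act M \<pi> n x y) (\<lambda>(l, z). g z + (\<Sum>(x, y)\<leftarrow>l. r x y))
    = r x y + trans_expect M x y (traj_value M \<pi> r g n)"
proof -
  have "measure_pmf.expectation (traj_from_act M \<pi> n x y) (\<lambda>(l, z). g z + (\<Sum>(x, y)\<leftarrow>l. r x y))
    = trans_expect M x y (\<lambda>x'. measure_pmf.expectation (traj_from M \<pi> n x')
         (\<lambda>(l, z). r x y + (g z + (\<Sum>(x, y)\<leftarrow>l. r x y))))"
    unfolding traj_from_act_def trans_expect_def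
    by (subst pmf_expectation_bind[of UNIV]) (auto simp: case_prod_unfold add.left_commute)
  also have "\<dots> = trans_expect M x y (\<lambda>x'. r x y + traj_value M \<pi> r g n x')"
    unfolding traj_value_def case_prod_beta
    by (subst Bochner_Integration.integral_add)
       (auto intro!: integrable_measure_pmf_finite)
  finally show ?thesis by (simp add: trans_expect_add trans_expect_const)
qed

lemma traj_value_Suc:
  fixes M :: "('x::finite, 'y::finite) pref_mdp"
  shows "traj_value M \<pi> r g (Suc n) x
    = (\<Sum>y\<in>UNIV. pmf (\<pi> x) y * (r x y + trans_expect M x y (traj_value M \<pi> r g n)))"
  unfolding traj_value_def[of M \<pi> r g "Suc n"] traj_from_Suc
  by (subst pmf_expectation_bind[of UNIV]) (auto simp: expectation_traj_from_act)

text \<open>Taking \<open>c = -1\<close> turns upper bounds on values into lower bounds.\<close>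

lemma traj_value_scale:
  fixes M :: "('x::finite, 'y::finite) pref_mdp"
  shows "traj_value M \<pi> (\<lambda>x y. c * r x y) (\<lambda>x. c * g x) n = (\<lambda>x. c * traj_value M \<pi> r g n x)"
proof (induction n)
  case (Suc n)
  show ?case
    by (rule ext) (simp add: traj_value_Suc Suc.IH trans_expect_mult sum_distrib_left algebra_simps)
qed (simp add: fun_eq_iff)

text \<open>
  A state-wise divergence and the pointwise log-ratio have the same conditional mean given the state,
  so either can serve as the running penalty.
\<close>

lemma traj_value_penalty:
  fixes M :: "('x::finite, 'y::finite) pref_mdp"
  shows "traj_value M \<pi> (\<lambda>x y. - \<alpha> * KL_act (\<pi> x) (\<mu> x)) g n = (\<lambda>x. traj_value M \<pi> (\<lambda>_ _. 0) g n x
    - \<alpha> * traj_value M \<pi> (\<lambda>x y. ln (pmf (\<pi> x) y / pmf (\<mu> x) y)) (\<lambda>_. 0) n x)"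
proof (induction n)
  case (Suc n)
  show ?case
  proof (rule ext)
    fix x
    have s: "(\<Sum>y\<in>UNIV. pmf (\<pi> x) y) = 1" by (rule sum_pmf_eq_1) auto
    have c: "(\<Sum>y\<in>UNIV. pmf (\<pi> x) y * (- \<alpha> * KL_act (\<pi> x) (\<mu> x))) = - \<alpha> * KL_act (\<pi> x) (\<mu> x)"
      by (simp only: s mult_1_left flip: sum_distrib_right)
    show "traj_value M \<pi> (\<lambda>x y. - \<alpha> * KL_act (\<pi> x) (\<mu> x)) g (Suc n) x
      = traj_value M \<pi> (\<lambda>_ _. 0) g (Suc n) x
        - \<alpha> * traj_value M \<pi> (\<lambda>x y. ln (pmf (\<pi> x) y / pmf (\<mu> x) y)) (\<lambda>_. 0) (Suc n) x"
      unfolding traj_value_Suc Suc.IH trans_expect_diff trans_expect_mult distrib_left sum.distrib c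
      by (simp add: KL_act_def right_diff_distrib sum_subtractf sum_negf sum_distrib_left algebra_simps)
  qed
qed (simp add: fun_eq_iff)

text \<open>The factor of a trajectory's probability that does not depend on the policy; it cancels in \<open>KL_traj\<close>.\<close>

primrec env_weight :: "('x::finite, 'y) pref_mdp \<Rightarrow> 'x \<Rightarrow> ('x \<times> 'y) list \<Rightarrow> 'x \<Rightarrow> real" where
  "env_weight M x [] z = (if x = z then 1 else 0)"
| "env_weight M x (a # l) z = (if fst a = x
     then \<Sum>x'\<in>UNIV. pmf (transition M x (snd a)) x' * env_weight M x' l z else 0)"

lemma pmf_map_Cons:
  "pmf (map_pmf (\<lambda>(l, z). (a # l, z)) P) (b # l, z) = (if a = b then pmf P (l, z) else 0)"
proof (cases "a = b")
  case True
  have "inj (\<lambda>(l, z). (a # l, z))" by (auto simp: inj_def)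
  from pmf_map_inj'[OF this, of P "(l, z)"] show ?thesis using True by simp
next
  case False
  then show ?thesis by (auto intro!: pmf_map_outside)
qed

text \<open>Recording states and actions separates policy from dynamics: each step contributes one
  action probability and one factor inside \<open>env_weight\<close>. Lists of another length get
  mass zero although \<open>env_weight\<close> may be positive on them.\<close>

lemma pmf_traj_from:
  fixes M :: "('x::finite, 'y::finite) pref_mdp"
  shows "pmf (traj_from M \<pi> n x) (l, z)
    = (if length l = n then (\<Prod>(x, y)\<leftarrow>l. pmf (\<pi> x) y) * env_weight M x l z else 0)"
proof (induction n arbitrary: x l)
  case 0
  show ?case by (auto simp: pmf_return split: split_indicator)
next
  case (Suc n)
  have bind: "pmf (bind_pmf p f) i = (\<Sum>a\<in>UNIV. pmf p a * pmf (f a) i)"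
    for p :: "'c::finite pmf" and f :: "'c \<Rightarrow> 'd pmf" and i
    unfolding pmf_bind by (subst integral_measure_pmf[of UNIV]) auto
  show ?case
  proof (cases l)
    case Nil
    then show ?thesis using length_traj_from[of l z M \<pi> "Suc n" x]
      by (auto simp del: traj_from.simps simp: set_pmf_iff)
  next
    case (Cons a l')
    obtain x1 y1 where a: "a = (x1, y1)" by (cases a)
    \<comment> \<open>Only the action \<open>y1\<close> recorded in the first pair contributes, and
      only if the recorded state \<open>x1\<close> is the starting state.\<close>
    have "pmf (traj_from M \<pi> (Suc n) x) (l, z) = (\<Sum>y\<in>UNIV. if y = y1 then pmf (\<pi> x) y *
        (if x = x1 then \<Sum>x'\<in>UNIV. pmf (transition M x y) x' * pmf (traj_from M \<pi> n x') (l', z) else 0) else 0)"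
      unfolding Cons a traj_from.simps bind pmf_map_Cons
    proof (intro sum.cong refl)
      fix y
      show "pmf (\<pi> x) y * (\<Sum>x'\<in>UNIV. pmf (transition M x y) x' *
          (if (x, y) = (x1, y1) then pmf (traj_from M \<pi> n x') (l', z) else 0))
        = (if y = y1 then pmf (\<pi> x) y *
        (if x = x1 then \<Sum>x'\<in>UNIV. pmf (transition M x y) x' * pmf (traj_from M \<pi> n x') (l', z) else 0) else 0)"
        by (cases "x = x1"; cases "y = y1") auto
    qed
    also have "\<dots> = pmf (\<pi> x) y1 *
        (if x = x1 then \<Sum>x'\<in>UNIV. pmf (transition M x y1) x' * pmf (traj_from M \<pi> n x') (l', z) else 0)"
      by simp
    finally show ?thesis
      by (auto simp: Cons a Suc.IH sum_distrib_left mult_ac)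
  qed
qed

section \<open>Backward induction over layers; divergences, Q-functions and preferences as
  trajectory values\<close>

context pref_mdp
begin

text \<open>With \<open>n\<close> steps left the state lies in layer
  \<open>horizon M + 1 - n\<close>; each transition keeps \<open>h + n\<close> fixed.\<close>

lemma traj_from_layers:
  assumes "(l, z) \<in> set_pmf (traj_from M \<pi> n x)" "x \<in> layer M h" "1 \<le> h" "h + n = horizon M + 1"
  shows "fst ` set l \<subseteq> nonterm_states M" "z \<in> layer M (horizon M + 1)"
proof -
  have "fst ` set l \<subseteq> nonterm_states M \<and> z \<in> layer M (horizon M + 1)"
    using assms
  proof (induction n arbitrary: h x l)
    case 0
    then show ?case by simp
  next
    case (Suc n)
    from Suc.prems(1) obtain y x' l' where l: "l = (x, y) # l'" and x': "x' \<in> set_pmf (transition M x y)"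
      and l': "(l', z) \<in> set_pmf (traj_from M \<pi> n x')"
      by auto
    have h: "h \<in> {1..horizon M}" using Suc.prems by simp
    have "x' \<in> layer M (h + 1)" using trans_layer[OF h] Suc.prems(2) x' by blast
    from Suc.IH[OF l' this] have "fst ` set l' \<subseteq> nonterm_states M \<and> z \<in> layer M (horizon M + 1)"
      using Suc.prems by simp
    moreover have "x \<in> nonterm_states M" using h Suc.prems(2) by (auto simp: nonterm_states_def)
    ultimately show ?case by (simp add: l)
  qed
  then show "fst ` set l \<subseteq> nonterm_states M" "z \<in> layer M (horizon M + 1)" by auto
qed

text \<open>A cost of \<open>c\<close> per step accumulates over the remaining steps.
  \<open>D\<close> may combine values of several policies, while averages are taken along the single
  policy \<open>\<pi>\<close>.\<close>

lemma backward_bound: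
  assumes base: "\<And>x. x \<in> layer M (horizon M + 1) \<Longrightarrow> D 0 x \<le> 0"
    and step: "\<And>h n x. 1 \<le> h \<Longrightarrow> h + n = horizon M \<Longrightarrow> x \<in> layer M h \<Longrightarrow>
      D (Suc n) x \<le> c + (\<Sum>y\<in>UNIV. pmf (\<pi> x) y * trans_expect M x y (D n))"
    and "1 \<le> h" "h + n = horizon M + 1" "x \<in> layer M h"
  shows "D n x \<le> real n * c"
  using assms(3-)
proof (induction n arbitrary: h x)
  case 0
  then show ?case using base by simp
next
  case (Suc n)
  have h: "h \<in> {1..horizon M}" using Suc.prems by simp
  have "trans_expect M x y (D n) \<le> real n * c" for y
  proof -
    have "trans_expect M x y (D n) \<le> trans_expect M x y (\<lambda>_. real n * c)"
    proof (rule trans_expect_mono)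
      fix x' assume "x' \<in> set_pmf (transition M x y)"
      then have "x' \<in> layer M (h + 1)" using trans_layer[OF h] Suc.prems by blast
      then show "D n x' \<le> real n * c" using Suc.prems by (intro Suc.IH[of "h + 1"]) auto
    qed
    then show ?thesis by (simp add: trans_expect_const)
  qed
  then have "(\<Sum>y\<in>UNIV. pmf (\<pi> x) y * trans_expect M x y (D n)) \<le> (\<Sum>y\<in>UNIV. pmf (\<pi> x) y * (real n * c))"
    by (intro sum_mono mult_left_mono) auto
  also have "\<dots> = real n * c"
    using sum_pmf_eq_1[of UNIV "\<pi> x"] by (simp flip: sum_distrib_right)
  finally show ?case using step[of h n x] Suc.prems by (simp add: algebra_simps)
qed

text \<open>Chain rule: \<open>env_weight\<close> cancels in the ratio of trajectory masses, whose
  logarithm is then the sum of the log-ratios of the actions. Admissibility relative to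
  \<open>\<pi>'\<close> yields absolute continuity of the trajectory laws.\<close>

lemma KL_traj_eq:
  assumes ac: "admissible M \<pi>' \<pi>"
  shows "KL_traj M \<pi> \<pi>' = traj_value M \<pi> (\<lambda>x y. ln (pmf (\<pi> x) y / pmf (\<pi>' x) y)) (\<lambda>_. 0) (horizon M) (init_state M)"
proof -
  have main: "pmf (traj_pmf M \<pi>') (l, z) \<noteq> 0 \<and>
      ln (pmf (traj_pmf M \<pi>) (l, z) / pmf (traj_pmf M \<pi>') (l, z)) = (\<Sum>(x, y)\<leftarrow>l. ln (pmf (\<pi> x) y / pmf (\<pi>' x) y))"
    if lz: "(l, z) \<in> set_pmf (traj_pmf M \<pi>)" for l z
  proof -
    have nt: "fst ` set l \<subseteq> nonterm_states M"
      using traj_from_layers(1)[of l z \<pi> "horizon M" "init_state M" 1] lz init_in by (auto simp: traj_pmf_def)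
    have len: "length l = horizon M" using lz by (auto simp: traj_pmf_def dest: length_traj_from)
    have nz: "(\<Prod>(x, y)\<leftarrow>l. pmf (\<pi> x) y) * env_weight M (init_state M) l z \<noteq> 0"
      using lz by (simp add: set_pmf_iff traj_pmf_def pmf_traj_from len)
    \<comment> \<open>All action factors of a trajectory of positive mass are positive, and
      admissibility carries this over to \<open>\<pi>'\<close>, so the logarithms split.\<close>
    have prods: "(\<Prod>(x, y)\<leftarrow>l. pmf (\<pi> x) y) > 0 \<Longrightarrow> fst ` set l \<subseteq> nonterm_states M \<Longrightarrow>
      (\<Prod>(x, y)\<leftarrow>l. pmf (\<pi>' x) y) > 0 \<and>
      ln ((\<Prod>(x, y)\<leftarrow>l. pmf (\<pi> x) y) / (\<Prod>(x, y)\<leftarrow>l. pmf (\<pi>' x) y))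
        = (\<Sum>(x, y)\<leftarrow>l. ln (pmf (\<pi> x) y / pmf (\<pi>' x) y))" for l
    proof (induction l)
      case Nil
      then show ?case by simp
    next
      case (Cons a l)
      obtain x y where a: "a = (x, y)" by (cases a)
      have nn: "(\<Prod>(x, y)\<leftarrow>l. pmf (\<pi> x) y) \<ge> 0"
        by (induction l) auto
      have pos: "pmf (\<pi> x) y > 0" "(\<Prod>(x, y)\<leftarrow>l. pmf (\<pi> x) y) > 0"
        using Cons.prems(1) nn by (auto simp: a zero_less_mult_iff dest: leD)
      moreover have "pmf (\<pi>' x) y > 0"
        using ac pos(1) Cons.prems(2) by (fastforce simp: admissible_def a order_less_le)
      ultimately show ?case
        using Cons.IH Cons.prems(2)
          ln_mult_pos[of "pmf (\<pi> x) y / pmf (\<pi>' x) y"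
            "(\<Prod>(x, y)\<leftarrow>l. pmf (\<pi> x) y) / (\<Prod>(x, y)\<leftarrow>l. pmf (\<pi>' x) y)"]
        by (simp add: a)
    qed
    have "(\<Prod>(x, y)\<leftarrow>l. pmf (\<pi> x) y) \<ge> 0"
      by (induction l) auto
    then have "(\<Prod>(x, y)\<leftarrow>l. pmf (\<pi> x) y) > 0" using nz by (simp add: order_less_le)
    from prods[OF this nt] show ?thesis
      using nz by (simp add: traj_pmf_def pmf_traj_from len)
  qed
  have "set_pmf (traj_pmf M \<pi>) \<subseteq> set_pmf (traj_pmf M \<pi>')"
    using main by (auto simp: set_pmf_iff)
  then have "KL_traj M \<pi> \<pi>' = measure_pmf.expectation (traj_pmf M \<pi>)
      (\<lambda>\<tau>. ln (pmf (traj_pmf M \<pi>) \<tau> / pmf (traj_pmf M \<pi>') \<tau>))"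
    unfolding KL_traj_def by (rule KL_divergence_pmf)
  also have "\<dots> = measure_pmf.expectation (traj_pmf M \<pi>)
      (\<lambda>(l, z). 0 + (\<Sum>(x, y)\<leftarrow>l. ln (pmf (\<pi> x) y / pmf (\<pi>' x) y)))"
    by (rule integral_cong_AE) (use main in \<open>auto simp: AE_measure_pmf_iff\<close>)
  finally show ?thesis by (simp add: traj_value_def traj_pmf_def)
qed

text \<open>The penalty at \<open>x\<close> is deterministic once the start is fixed; what remains
  is the mean regularised value one layer later.\<close>

lemma Q_fun_eq:
  assumes h: "h \<in> {1..horizon M}"
  shows "Q_fun M \<mu> \<alpha> \<pi> \<pi>' h x y = - \<alpha> * KL_act (\<pi> x) (\<mu> x) + trans_expect M x y
    (traj_value M \<pi> (\<lambda>x y. - \<alpha> * KL_act (\<pi> x) (\<mu> x)) (\<lambda>z. pref_state_policy M z \<pi>') (horizon M - h))"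
proof -
  let ?K = "\<lambda>x. KL_act (\<pi> x) (\<mu> x)"
  have "Q_fun M \<mu> \<alpha> \<pi> \<pi>' h x y = measure_pmf.expectation (traj_from_act M \<pi> (horizon M - h) x y)
      (\<lambda>(l, z). pref_state_policy M z \<pi>' + (\<Sum>(x, y)\<leftarrow>l. - \<alpha> * ?K x))"
    unfolding Q_fun_def
  proof (rule integral_cong_AE)
    have "pref_state_policy M z \<pi>' - \<alpha> * (\<Sum>h'=h..horizon M. ?K (fst (l ! (h' - h))))
        = pref_state_policy M z \<pi>' + (\<Sum>(x, y)\<leftarrow>l. - \<alpha> * ?K x)"
      if "(l, z) \<in> set_pmf (traj_from_act M \<pi> (horizon M - h) x y)" for l z
    proof -
      have len: "length l = Suc (horizon M) - h"
        using that h by (auto simp: traj_from_act_def dest!: length_traj_from)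
      \<comment> \<open>Position \<open>i\<close> of the list belongs to layer \<open>h + i\<close>;
        there are \<open>horizon M - h + 1\<close> positions, the prescribed first pair
        included.\<close>
      have "(\<Sum>h'=h..horizon M. ?K (fst (l ! (h' - h)))) = (\<Sum>i<length l. ?K (fst (l ! i)))"
        by (rule sum.reindex_bij_witness[of _ "\<lambda>i. i + h" "\<lambda>i. i - h"]) (use h in \<open>auto simp: len\<close>)
      then show ?thesis
        by (simp add: sum_list_sum_nth sum_distrib_left case_prod_beta sum_negf atLeast0LessThan)
    qed
    then show "AE \<tau> in measure_pmf (traj_from_act M \<pi> (horizon M - h) x y).
      (case \<tau> of (l, z) \<Rightarrow> pref_state_policy M z \<pi>' - \<alpha> * (\<Sum>h'=h..horizon M. ?K (fst (l ! (h' - h)))))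
      = (case \<tau> of (l, z) \<Rightarrow> pref_state_policy M z \<pi>' + (\<Sum>(x, y)\<leftarrow>l. - \<alpha> * ?K x))"
      by (auto simp: AE_measure_pmf_iff)
  qed auto
  then show ?thesis by (simp only: expectation_traj_from_act)
qed

lemma pref_state_policy_eq:
  "pref_state_policy M x \<pi> = traj_value M \<pi> (\<lambda>_ _. 0) (pref M x) (horizon M) (init_state M)"
  by (simp add: pref_state_policy_def traj_value_def traj_pmf_def case_prod_unfold)

lemma pref_policy_eq:
  "pref_policy M \<pi> \<pi>' = traj_value M \<pi> (\<lambda>_ _. 0) (\<lambda>z. pref_state_policy M z \<pi>') (horizon M) (init_state M)"
  by (simp add: pref_policy_def traj_value_def traj_pmf_def case_prod_unfold)

lemma traj_value_le:
  assumes "\<And>z. z \<in> layer M (horizon M + 1) \<Longrightarrow> g z \<le> G"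
    and "\<And>x y. x \<in> nonterm_states M \<Longrightarrow> r x y \<le> R"
    and "1 \<le> h" "h + n = horizon M + 1" "x \<in> layer M h"
  shows "traj_value M \<pi> r g n x \<le> G + real n * R"
proof -
  have "traj_value M \<pi> r g n x - G \<le> real n * R"
  proof (rule backward_bound[where \<pi> = \<pi> and D = "\<lambda>n x. traj_value M \<pi> r g n x - G"])
    fix h n x assume h: "1 \<le> h" "h + n = horizon M" "x \<in> layer M h"
    have s: "(\<Sum>y\<in>UNIV. pmf (\<pi> x) y) = 1" by (rule sum_pmf_eq_1) auto
    have x: "x \<in> nonterm_states M" using h by (auto simp: nonterm_states_def)
    have "traj_value M \<pi> r g (Suc n) x - G - (\<Sum>y\<in>UNIV. pmf (\<pi> x) y * trans_expect M x y (\<lambda>x. traj_value M \<pi> r g n x - G))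
       = (\<Sum>y\<in>UNIV. pmf (\<pi> x) y * r x y)"
      by (simp add: traj_value_Suc trans_expect_diff trans_expect_const distrib_left right_diff_distrib
          sum.distrib sum_subtractf s flip: sum_distrib_right)
    also have "\<dots> \<le> (\<Sum>y\<in>UNIV. pmf (\<pi> x) y * R)"
      by (intro sum_mono mult_left_mono assms(2) x) auto
    also have "\<dots> = R" by (simp add: s flip: sum_distrib_right)
    finally show "traj_value M \<pi> r g (Suc n) x - G
      \<le> R + (\<Sum>y\<in>UNIV. pmf (\<pi> x) y * trans_expect M x y (\<lambda>x. traj_value M \<pi> r g n x - G))" by simp
  qed (use assms in auto)
  then show ?thesis by simp
qed

lemma traj_value_ge:
  assumes "\<And>z. z \<in> layer M (horizon M + 1) \<Longrightarrow> G \<le> g z"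
    and "\<And>x y. x \<in> nonterm_states M \<Longrightarrow> R \<le> r x y"
    and "1 \<le> h" "h + n = horizon M + 1" "x \<in> layer M h"
  shows "G + real n * R \<le> traj_value M \<pi> r g n x"
  using traj_value_le[of "\<lambda>x. (-1) * g x" "- G" "\<lambda>x y. (-1) * r x y" "- R" h n x \<pi>] assms
  by (simp only: traj_value_scale) simp

lemma pref_state_policy_range:
  assumes "z \<in> layer M (horizon M + 1)"
  shows "pref_state_policy M z \<pi> \<in> {0..1}"
proof -
  have "pref_state_policy M z \<pi> \<le> 1 + real (horizon M) * 0"
    unfolding pref_state_policy_eq
    by (rule traj_value_le[of _ _ _ _ 1]) (use assms pref_range init_in in \<open>fastforce+\<close>)
  moreover have "0 + real (horizon M) * 0 \<le> pref_state_policy M z \<pi>"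
    unfolding pref_state_policy_eq
    by (rule traj_value_ge[of _ _ _ _ 1]) (use assms pref_range init_in in \<open>fastforce+\<close>)
  ultimately show ?thesis by simp
qed

text \<open>Two independent terminal states with the same law may be exchanged, so the win
  probability \<open>S\<close> satisfies \<open>S = 1 - S\<close>.\<close>

lemma pref_policy_self: "pref_policy M \<pi> \<pi> = 1 / 2"
proof -
  define D where "D = map_pmf snd (traj_pmf M \<pi>)"
  have E: "measure_pmf.expectation (traj_pmf M \<pi>) (\<lambda>(l, z). f z) = (\<Sum>z\<in>UNIV. pmf D z * f z)"
    for f :: "'x \<Rightarrow> real"
  proof -
    have "measure_pmf.expectation (traj_pmf M \<pi>) (\<lambda>(l, z). f z) = measure_pmf.expectation D f"
      by (simp add: D_def case_prod_unfold)
    then show ?thesis by (subst (asm) (2) integral_measure_pmf[of UNIV]) auto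
  qed
  \<comment> \<open>Complementarity of preferences is given on the terminal layer, which carries all
    the mass of \<open>D\<close>.\<close>
  have supp: "z \<in> layer M (horizon M + 1)" if "pmf D z \<noteq> 0" for z
    using that traj_from_layers(2)[of _ z \<pi> "horizon M" "init_state M" 1] init_in
    by (auto simp: D_def traj_pmf_def simp flip: set_pmf_iff)
  have s: "(\<Sum>z\<in>UNIV. pmf D z) = 1" by (rule sum_pmf_eq_1) auto
  define S where "S = (\<Sum>z\<in>UNIV. \<Sum>z'\<in>UNIV. pmf D z * pmf D z' * pref M z z')"
  have P: "pref_policy M \<pi> \<pi> = S"
    unfolding pref_policy_def pref_state_policy_def E S_def by (simp add: sum_distrib_left mult.assoc)
  have "S = (\<Sum>z\<in>UNIV. \<Sum>z'\<in>UNIV. pmf D z * pmf D z' * (1 - pref M z' z))"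
    unfolding S_def
  proof (intro sum.cong refl)
    fix z z'
    show "pmf D z * pmf D z' * pref M z z' = pmf D z * pmf D z' * (1 - pref M z' z)"
    proof (cases "pmf D z = 0 \<or> pmf D z' = 0")
      case False
      then show ?thesis using pref_compl[of z' z] supp by simp
    qed auto
  qed
  also have "\<dots> = (\<Sum>z\<in>UNIV. pmf D z * (\<Sum>z'\<in>UNIV. pmf D z')) - (\<Sum>z\<in>UNIV. \<Sum>z'\<in>UNIV. pmf D z' * pmf D z * pref M z' z)"
    by (simp add: right_diff_distrib sum_subtractf sum_distrib_left mult_ac)
  also have "(\<Sum>z\<in>UNIV. \<Sum>z'\<in>UNIV. pmf D z' * pmf D z * pref M z' z) = S"
    unfolding S_def by (rule sum.swap)
  finally show ?thesis using s P by simp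
qed

end

section \<open>The local mirror descent step\<close>

text \<open>The geometric mixture of \<open>m\<close> and \<open>p\<close> tilted by
  \<open>exp (\<eta> * Q y)\<close>. The case distinction matters: with \<open>ln 0 = 0\<close> the
  exponential would be positive outside the support of \<open>m\<close>.\<close>

definition mirror_weight :: "'y pmf \<Rightarrow> 'y pmf \<Rightarrow> real \<Rightarrow> real \<Rightarrow> ('y \<Rightarrow> real) \<Rightarrow> 'y \<Rightarrow> real" where
  "mirror_weight m p \<beta> \<eta> Q y = (if pmf m y = 0 then 0
     else exp (\<beta> * ln (pmf m y) + (1 - \<beta>) * ln (pmf p y) + \<eta> * Q y))"

lemma mirror_weight_nonneg: "mirror_weight m p \<beta> \<eta> Q y \<ge> 0"
  by (simp add: mirror_weight_def)

lemma mirror_weight_pos_iff: "mirror_weight m p \<beta> \<eta> Q y > 0 \<longleftrightarrow> pmf m y > 0"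
  by (simp add: mirror_weight_def order_less_le)

text \<open>The logarithm of the weight collects both divergences and the linear term, so maximising
  the objective means minimising the functional in \<open>gibbs\<close>.\<close>

lemma mirror_objective:
  fixes m p q :: "'y::finite pmf"
  assumes supp_p: "\<And>y. pmf m y > 0 \<Longrightarrow> pmf p y > 0" and supp_q: "\<And>y. pmf q y > 0 \<Longrightarrow> pmf m y > 0"
  shows "\<eta> * (\<Sum>y\<in>UNIV. pmf q y * Q y) - \<beta> * KL_act q m - (1 - \<beta>) * KL_act q p
    = - (\<Sum>y\<in>UNIV. pmf q y * ln (pmf q y / mirror_weight m p \<beta> \<eta> Q y))"
proof -
  have "pmf q y * ln (pmf q y / mirror_weight m p \<beta> \<eta> Q y)
    = \<beta> * (pmf q y * ln (pmf q y / pmf m y)) + (1 - \<beta>) * (pmf q y * ln (pmf q y / pmf p y))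
      - \<eta> * (pmf q y * Q y)" for y
  proof (cases "pmf q y > 0")
    case True
    with supp_q[OF True] supp_p[of y] show ?thesis
      by (simp add: mirror_weight_def ln_div algebra_simps)
  next
    case False
    then have "pmf q y = 0" by (simp add: order.antisym not_less)
    then show ?thesis by simp
  qed
  then show ?thesis
    by (simp add: KL_act_def sum.distrib sum_subtractf sum_distrib_left)
qed

text \<open>The normalised weight is feasible and attains the Gibbs lower bound
  \<open>- ln Z\<close>. A maximiser must then attain it too, and the equality case determines
  it.\<close>

lemma mirror_argmax:
  fixes m p p' :: "'y::finite pmf"
  assumes supp_p: "\<And>y. pmf m y > 0 \<Longrightarrow> pmf p y > 0"
    and argmax: "is_arg_max (\<lambda>q. \<eta> * (\<Sum>y\<in>UNIV. pmf q y * Q y) - \<beta> * KL_act q m - (1 - \<beta>) * KL_act q p)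
      (\<lambda>q. \<forall>y. pmf m y = 0 \<longrightarrow> pmf q y = 0) p'"
  shows "pmf p' y = mirror_weight m p \<beta> \<eta> Q y / (\<Sum>y\<in>UNIV. mirror_weight m p \<beta> \<eta> Q y)"
proof -
  let ?w = "mirror_weight m p \<beta> \<eta> Q"
  define Z where "Z = (\<Sum>y\<in>UNIV. ?w y)"
  have Z: "Z > 0" unfolding Z_def
    by (rule gibbs_pos[of _ m]) (simp_all add: mirror_weight_nonneg mirror_weight_pos_iff)
  have supp: "pmf m y > 0" if "pmf q y > 0" "\<forall>y. pmf m y = 0 \<longrightarrow> pmf q y = 0" for q :: "'y pmf" and y
    using that by (metis less_irrefl pmf_pos)
  define T where "T = embed_pmf (\<lambda>y. ?w y / Z)"
  have T: "pmf T y = ?w y / Z" for y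
    unfolding T_def
  proof (rule pmf_embed_pmf)
    have "(\<integral>\<^sup>+y. ennreal (?w y / Z) \<partial>count_space UNIV) = ennreal (\<Sum>y\<in>UNIV. ?w y / Z)"
      using Z by (subst nn_integral_count_space_finite) (auto simp: mirror_weight_nonneg intro!: sum_ennreal)
    also have "(\<Sum>y\<in>UNIV. ?w y / Z) = 1" using Z by (simp add: Z_def flip: sum_divide_distrib)
    finally show "(\<integral>\<^sup>+y. ennreal (?w y / Z) \<partial>count_space UNIV) = 1" by simp
  qed (use Z in \<open>simp add: mirror_weight_nonneg\<close>)
  have T_supp: "\<forall>y. pmf m y = 0 \<longrightarrow> pmf T y = 0" by (simp add: T mirror_weight_def)
  have p'_supp: "\<forall>y. pmf m y = 0 \<longrightarrow> pmf p' y = 0" using argmax by (simp add: is_arg_max_def)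
  have obj: "\<eta> * (\<Sum>y\<in>UNIV. pmf q y * Q y) - \<beta> * KL_act q m - (1 - \<beta>) * KL_act q p
      = - (\<Sum>y\<in>UNIV. pmf q y * ln (pmf q y / ?w y))"
    if "\<forall>y. pmf m y = 0 \<longrightarrow> pmf q y = 0" for q
    by (rule mirror_objective) (use supp_p supp that in auto)
  have "(\<Sum>y\<in>UNIV. pmf p' y * ln (pmf p' y / ?w y)) \<le> (\<Sum>y\<in>UNIV. pmf T y * ln (pmf T y / ?w y))"
  proof -
    have "\<eta> * (\<Sum>y\<in>UNIV. pmf T y * Q y) - \<beta> * KL_act T m - (1 - \<beta>) * KL_act T p
        \<le> \<eta> * (\<Sum>y\<in>UNIV. pmf p' y * Q y) - \<beta> * KL_act p' m - (1 - \<beta>) * KL_act p' p"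
      using argmax T_supp unfolding is_arg_max_def not_less[symmetric] by blast
    then show ?thesis unfolding obj[OF T_supp] obj[OF p'_supp] by simp
  qed
  also have "\<dots> = (\<Sum>y\<in>UNIV. pmf T y * (- ln Z))"
  proof (rule sum.cong[OF refl])
    fix y
    show "pmf T y * ln (pmf T y / ?w y) = pmf T y * (- ln Z)"
      using Z by (cases "?w y = 0") (simp_all add: T ln_div)
  qed
  also have "\<dots> = - ln Z"
    using sum_pmf_eq_1[of UNIV T] by (simp add: sum_negf flip: sum_distrib_right)
  finally show ?thesis
    unfolding Z_def
    by (intro gibbs_eq) (auto simp: mirror_weight_nonneg mirror_weight_pos_iff intro: supp[OF _ p'_supp])
qed

text \<open>Up to a constant, the new scaled log-ratio is the convex combination of the old one and
  \<open>Q\<close> with weights \<open>1 - \<alpha> * \<eta>\<close> and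
  \<open>\<alpha> * \<eta>\<close>. Hence the same \<open>B\<close> survives any number of
  steps.\<close>

lemma mirror_step_invariant:
  fixes m p p' :: "'y::finite pmf"
  assumes supp_p: "\<And>y. pmf m y > 0 \<Longrightarrow> pmf p y > 0"
    and p': "\<And>y. pmf p' y = mirror_weight m p (\<alpha> * \<eta>) \<eta> Q y / (\<Sum>y\<in>UNIV. mirror_weight m p (\<alpha> * \<eta>) \<eta> Q y)"
    and inv: "\<And>y. pmf m y > 0 \<Longrightarrow> \<bar>\<alpha> * ln (pmf p y / pmf m y) - c\<bar> \<le> B"
    and Q: "\<And>y. \<bar>Q y\<bar> \<le> B"
    and \<beta>: "0 \<le> \<alpha> * \<eta>" "\<alpha> * \<eta> \<le> 1"
  shows "pmf p' y > 0 \<longleftrightarrow> pmf m y > 0"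
    and "\<exists>c'. \<forall>y. pmf m y > 0 \<longrightarrow> \<bar>\<alpha> * ln (pmf p' y / pmf m y) - c'\<bar> \<le> B"
proof -
  let ?w = "mirror_weight m p (\<alpha> * \<eta>) \<eta> Q"
  define Z where "Z = (\<Sum>y\<in>UNIV. ?w y)"
  have Z: "Z > 0" unfolding Z_def
    by (rule gibbs_pos[of _ m]) (simp_all add: mirror_weight_nonneg mirror_weight_pos_iff)
  note p' = p'[folded Z_def]
  show "pmf p' y > 0 \<longleftrightarrow> pmf m y > 0"
    using Z by (simp add: p' zero_less_divide_iff mirror_weight_pos_iff)
  \<comment> \<open>The normaliser does not depend on \<open>y\<close> and is absorbed into the new
    constant.\<close>
  have "\<bar>\<alpha> * ln (pmf p' y / pmf m y) - ((1 - \<alpha> * \<eta>) * c - \<alpha> * ln Z)\<bar> \<le> B" if y: "pmf m y > 0" for y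
  proof -
    have "\<alpha> * ln (pmf p' y / pmf m y) - ((1 - \<alpha> * \<eta>) * c - \<alpha> * ln Z)
      = (1 - \<alpha> * \<eta>) * (\<alpha> * ln (pmf p y / pmf m y) - c) + \<alpha> * \<eta> * Q y"
      using y supp_p[OF y] Z by (simp add: p' mirror_weight_def ln_div ln_mult_pos algebra_simps)
    also have "\<bar>\<dots>\<bar> \<le> (1 - \<alpha> * \<eta>) * \<bar>\<alpha> * ln (pmf p y / pmf m y) - c\<bar> + \<alpha> * \<eta> * \<bar>Q y\<bar>"
      using \<beta> abs_triangle_ineq by (metis abs_mult abs_of_nonneg diff_ge_0_iff_ge)
    also have "\<dots> \<le> (1 - \<alpha> * \<eta>) * B + \<alpha> * \<eta> * B"
      using \<beta> inv[OF y] Q[of y] by (intro add_mono mult_left_mono) auto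
    finally show ?thesis by (simp add: algebra_simps)
  qed
  then show "\<exists>c'. \<forall>y. pmf m y > 0 \<longrightarrow> \<bar>\<alpha> * ln (pmf p' y / pmf m y) - c'\<bar> \<le> B" by blast
qed

text \<open>The update formula gives \<open>KL_act s p'\<close> exactly, up to estimating
  \<open>ln Z\<close>. The latter is a log-moment under \<open>p\<close> of a bounded variable, so
  the error is of second order in \<open>\<eta>\<close> and free of the smallest probability of
  \<open>m\<close>.\<close>

lemma mirror_step_descent:
  fixes m p p' s :: "'y::finite pmf"
  assumes supp_p: "\<And>y. pmf p y > 0 \<longleftrightarrow> pmf m y > 0"
    and supp_s: "\<And>y. pmf s y > 0 \<Longrightarrow> pmf m y > 0"
    and p': "\<And>y. pmf p' y = mirror_weight m p (\<alpha> * \<eta>) \<eta> Q y / (\<Sum>y\<in>UNIV. mirror_weight m p (\<alpha> * \<eta>) \<eta> Q y)"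
    and inv: "\<And>y. pmf m y > 0 \<Longrightarrow> \<bar>\<alpha> * ln (pmf p y / pmf m y) - c\<bar> \<le> B"
    and Q: "\<And>y. \<bar>Q y\<bar> \<le> B"
    and \<eta>: "\<eta> > 0"
  shows "KL_act s p' \<le> (1 - \<alpha> * \<eta>) * KL_act s p
    + \<eta> * ((\<Sum>y\<in>UNIV. pmf p y * Q y) - (\<Sum>y\<in>UNIV. pmf s y * Q y) + \<alpha> * KL_act s m - \<alpha> * KL_act p m)
    + 2 * \<eta>\<^sup>2 * B\<^sup>2"
proof -
  let ?w = "mirror_weight m p (\<alpha> * \<eta>) \<eta> Q"
  define Z where "Z = (\<Sum>y\<in>UNIV. ?w y)"
  have Z: "Z > 0" unfolding Z_def
    by (rule gibbs_pos[of _ m]) (simp_all add: mirror_weight_nonneg mirror_weight_pos_iff)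
  note p' = p'[folded Z_def]
  have sum1: "(\<Sum>y\<in>UNIV. pmf q y) = 1" for q :: "'y pmf" by (rule sum_pmf_eq_1) auto
  have pos_m: "pmf m y > 0" if "pmf m y \<noteq> 0" for y using that by (simp add: order_less_le)
  have "KL_act s p' = (\<Sum>y\<in>UNIV. pmf s y * ln (pmf s y / ?w y) + pmf s y * ln Z)"
    unfolding KL_act_def
  proof (rule sum.cong[OF refl])
    fix y
    show "pmf s y * ln (pmf s y / pmf p' y) = pmf s y * ln (pmf s y / ?w y) + pmf s y * ln Z"
    proof (cases "pmf s y > 0")
      case True
      then have "?w y > 0" using supp_s by (simp add: mirror_weight_pos_iff)
      with True Z show ?thesis by (simp add: p' ln_div ln_mult algebra_simps)
    next
      case False
      then have "pmf s y = 0" by (simp add: order.antisym not_less)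
      then show ?thesis by simp
    qed
  qed
  also have "\<dots> = (\<Sum>y\<in>UNIV. pmf s y * ln (pmf s y / ?w y)) + ln Z"
    by (simp add: sum.distrib sum1 flip: sum_distrib_right)
  finally have KL: "KL_act s p' = (\<alpha> * \<eta>) * KL_act s m + (1 - \<alpha> * \<eta>) * KL_act s p
      - \<eta> * (\<Sum>y\<in>UNIV. pmf s y * Q y) + ln Z"
    using mirror_objective[of m p s \<eta> Q "\<alpha> * \<eta>"] supp_p supp_s by simp
  \<comment> \<open>This regrouping makes \<open>Z\<close> a multiple of the \<open>p\<close>-mean
    of \<open>exp (\<eta> * f y)\<close>. One \<open>B\<close> comes from \<open>Q\<close> and one
    from the invariant; the range has width \<open>4 * B\<close>, and its square over 8 gives
    \<open>2 * B\<^sup>2\<close>.\<close>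
  define f where "f y = Q y - (\<alpha> * ln (pmf p y / pmf m y) - c)" for y
  have f: "f y \<in> {- (2 * B)..2 * B}" if "pmf p y > 0" for y
    using Q[of y] inv[of y] supp_p that by (auto simp: f_def abs_le_iff)
  have "?w y = exp (- \<eta> * c) * (pmf p y * exp (\<eta> * f y))" for y
  proof (cases "pmf m y = 0")
    case True
    then have "pmf p y = 0" using supp_p by (metis less_irrefl pmf_pos)
    with True show ?thesis by (simp add: mirror_weight_def)
  next
    case False
    then have pos: "pmf m y > 0" "pmf p y > 0" using pos_m supp_p by auto
    have "?w y = exp (- \<eta> * c + ln (pmf p y) + \<eta> * f y)"
      using pos by (simp add: mirror_weight_def f_def ln_div algebra_simps)
    then show ?thesis using pos by (simp add: exp_add exp_diff exp_minus field_simps)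
  qed
  then have "Z = exp (- \<eta> * c) * (\<Sum>y\<in>UNIV. pmf p y * exp (\<eta> * f y))"
    by (simp add: Z_def sum_distrib_left)
  moreover have "(\<Sum>y\<in>UNIV. pmf p y * exp (\<eta> * f y)) > 0"
    by (rule gibbs_pos[of _ p]) auto
  ultimately have "ln Z = - \<eta> * c + ln (\<Sum>y\<in>UNIV. pmf p y * exp (\<eta> * f y))"
    by (simp add: ln_mult_pos)
  also have "ln (\<Sum>y\<in>UNIV. pmf p y * exp (\<eta> * f y))
      \<le> \<eta> * (\<Sum>y\<in>UNIV. pmf p y * f y) + \<eta>\<^sup>2 * (2 * B - - (2 * B))\<^sup>2 / 8"
    by (rule ln_expectation_exp_le[OF f \<eta>])
  also have "(\<Sum>y\<in>UNIV. pmf p y * f y) = (\<Sum>y\<in>UNIV. pmf p y * Q y) - \<alpha> * KL_act p m + c"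
    by (simp add: f_def KL_act_def right_diff_distrib distrib_left sum.distrib sum_subtractf sum1
        sum_distrib_left mult.left_commute flip: sum_distrib_right)
  finally have "ln Z \<le> \<eta> * ((\<Sum>y\<in>UNIV. pmf p y * Q y) - \<alpha> * KL_act p m) + 2 * \<eta>\<^sup>2 * B\<^sup>2"
    by (simp add: algebra_simps power2_eq_square)
  then show ?thesis by (simp add: KL algebra_simps)
qed

section \<open>Convergence of MTPO\<close>

context pref_mdp
begin

text \<open>Trajectories act only at nonterminal states, and only there is the first iterate
  prescribed to equal \<open>\<mu>\<close>.\<close>

lemma traj_pmf_cong:
  assumes "\<And>x. x \<in> nonterm_states M \<Longrightarrow> \<pi> x = \<pi>' x"
  shows "traj_pmf M \<pi> = traj_pmf M \<pi>'"
proof -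
  have "1 \<le> h \<Longrightarrow> h + n = horizon M + 1 \<Longrightarrow> x \<in> layer M h \<Longrightarrow> traj_from M \<pi> n x = traj_from M \<pi>' n x" for h n x
  proof (induction n arbitrary: h x)
    case (Suc n)
    have h: "h \<in> {1..horizon M}" using Suc.prems by simp
    have "x \<in> nonterm_states M" using h Suc.prems by (auto simp: nonterm_states_def)
    then have "\<pi> x = \<pi>' x" by (rule assms)
    moreover have "traj_from M \<pi> n x' = traj_from M \<pi>' n x'" if "x' \<in> set_pmf (transition M x y)" for x' y
      using Suc.IH[of "h + 1" x'] Suc.prems trans_layer[OF h, of x y] that by auto
    ultimately show ?case by (auto intro!: bind_pmf_cong)
  qed simp
  from this[of 1 "horizon M" "init_state M"] show ?thesis
    using init_in by (simp add: traj_pmf_def)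
qed

lemma nonterm_statesI: "1 \<le> h \<Longrightarrow> h \<le> horizon M \<Longrightarrow> x \<in> layer M h \<Longrightarrow> x \<in> nonterm_states M"
  by (auto simp: nonterm_states_def)

lemma nonterm_statesE:
  assumes "x \<in> nonterm_states M"
  obtains h where "h \<in> {1..horizon M}" "x \<in> layer M h"
  using assms by (auto simp: nonterm_states_def)

section \<open>Equilibrium inequalities in terms of regularised values\<close>

lemma regularized_value:
  assumes "admissible M \<mu> \<pi>"
  shows "traj_value M \<pi> (\<lambda>x y. - \<alpha> * KL_act (\<pi> x) (\<mu> x)) (\<lambda>z. pref_state_policy M z \<pi>') (horizon M) (init_state M)
    = pref_policy M \<pi> \<pi>' - \<alpha> * KL_traj M \<pi> \<mu>"
  by (simp only: traj_value_penalty pref_policy_eq KL_traj_eq[OF assms])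

text \<open>The \<open>1 / 2\<close> on either side is the win probability in self-play. The first
  inequality drives the descent, the second bounds the initial divergence.\<close>

lemma nash_regularized_value:
  assumes "is_nash M \<mu> \<alpha> \<pi>s" "admissible M \<mu> \<pi>"
  shows "1 / 2 - \<alpha> * KL_traj M \<pi> \<mu> \<le> pref_policy M \<pi>s \<pi> - \<alpha> * KL_traj M \<pi>s \<mu>"
    and "pref_policy M \<pi> \<pi>s - \<alpha> * KL_traj M \<pi> \<mu> \<le> 1 / 2 - \<alpha> * KL_traj M \<pi>s \<mu>"
  using assms by (auto simp: is_nash_def reg_pref_def pref_policy_self dest!: spec[of _ \<pi>])

lemma KL_traj_self: "KL_traj M \<pi> \<pi> = 0"
  unfolding KL_traj_def by (rule sigma_finite_measure.KL_same_eq_0) unfold_locales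

text \<open>By the equilibrium property, passing from \<open>\<mu>\<close> to \<open>\<pi>s\<close>
  raises the win probability against \<open>\<pi>s\<close> by at least \<open>\<alpha>\<close> times
  the divergence. The variational inequality caps this gain by half of that amount plus
  \<open>1 / (4 * \<alpha>)\<close> per step, so half of the penalty is controlled.\<close>

lemma nash_KL_reference:
  assumes nash: "is_nash M \<mu> \<alpha> \<pi>s" and \<alpha>: "\<alpha> > 0"
  shows "KL_traj M \<pi>s \<mu> \<le> real (horizon M) / (2 * \<alpha>\<^sup>2)"
proof -
  have adm: "admissible M \<mu> \<pi>s" using nash by (simp add: is_nash_def)
  let ?g = "\<lambda>z. pref_state_policy M z \<pi>s"
  define K where "K = traj_value M \<pi>s (\<lambda>x y. ln (pmf (\<pi>s x) y / pmf (\<mu> x) y)) (\<lambda>_. 0)"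
  define U where "U \<pi> = traj_value M \<pi> (\<lambda>_ _. 0) ?g" for \<pi>
  define D where "D n x = U \<pi>s n x - U \<mu> n x - \<alpha> / 2 * K n x" for n x
  have "D (horizon M) (init_state M) \<le> real (horizon M) * (1 / (4 * \<alpha>))"
  proof (rule backward_bound[where h = 1 and \<pi> = \<pi>s])
    fix h n x assume h: "1 \<le> h" "h + n = horizon M" "x \<in> layer M h"
    define f where "f y = trans_expect M x y (U \<mu> n)" for y
    have "f y \<in> {0..1}" for y
    proof -
      have U: "U \<mu> n x' \<in> {0..1}" if "x' \<in> set_pmf (transition M x y)" for x'
      proof -
        have x': "x' \<in> layer M (h + 1)" using that trans_layer[of h x y] h by auto
        have "U \<mu> n x' \<le> 1 + real n * 0" "0 + real n * 0 \<le> U \<mu> n x'"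
          unfolding U_def
          by (rule traj_value_le[of _ _ _ _ "h + 1"] traj_value_ge[of _ _ _ _ "h + 1"];
              use x' h pref_state_policy_range in fastforce)+
        then show ?thesis by simp
      qed
      have "f y \<le> trans_expect M x y (\<lambda>_. 1)" "trans_expect M x y (\<lambda>_. 0) \<le> f y"
        unfolding f_def by (rule trans_expect_mono; use U in force)+
      then show ?thesis by (simp add: trans_expect_const)
    qed
    note f = this
    have x: "x \<in> nonterm_states M" using h by (intro nonterm_statesI) auto
    have ac: "pmf (\<mu> x) y > 0" if "pmf (\<pi>s x) y > 0" for y
      using that adm x by (fastforce simp: admissible_def order_less_le)
    \<comment> \<open>The scale \<open>2 / \<alpha>\<close> leads to the coefficient
      \<open>\<alpha> / 2\<close> of the divergence; as \<open>f\<close> has range of width 1, the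
      Hoeffding term becomes \<open>1 / (4 * \<alpha>)\<close>.\<close>
    have "(\<Sum>y\<in>UNIV. pmf (\<pi>s x) y * (2 / \<alpha> * f y))
        \<le> KL_act (\<pi>s x) (\<mu> x) + ln (\<Sum>y\<in>UNIV. pmf (\<mu> x) y * exp (2 / \<alpha> * f y))"
      by (rule variational_KL_act) (rule ac)
    also have "ln (\<Sum>y\<in>UNIV. pmf (\<mu> x) y * exp (2 / \<alpha> * f y))
        \<le> 2 / \<alpha> * (\<Sum>y\<in>UNIV. pmf (\<mu> x) y * f y) + (2 / \<alpha>)\<^sup>2 * (1 - 0)\<^sup>2 / 8"
      by (rule ln_expectation_exp_le) (use f \<alpha> in auto)
    also have "(\<Sum>y\<in>UNIV. pmf (\<pi>s x) y * (2 / \<alpha> * f y)) = 2 / \<alpha> * (\<Sum>y\<in>UNIV. pmf (\<pi>s x) y * f y)"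
      by (simp add: sum_distrib_left algebra_simps)
    finally have "\<alpha> / 2 * (2 / \<alpha> * (\<Sum>y\<in>UNIV. pmf (\<pi>s x) y * f y))
       \<le> \<alpha> / 2 * (KL_act (\<pi>s x) (\<mu> x) + (2 / \<alpha> * (\<Sum>y\<in>UNIV. pmf (\<mu> x) y * f y) + (2 / \<alpha>)\<^sup>2 * (1 - 0)\<^sup>2 / 8))"
      using \<alpha> by (intro mult_left_mono) auto
    moreover have "\<alpha> / 2 * (2 / \<alpha> * X) = X" for X using \<alpha> by simp
    moreover have "\<alpha> / 2 * ((2 / \<alpha>)\<^sup>2 * (1 - 0)\<^sup>2 / 8) = 1 / (4 * \<alpha>)"
      using \<alpha> by (simp add: field_simps power2_eq_square)
    ultimately have local_bound: "(\<Sum>y\<in>UNIV. pmf (\<pi>s x) y * f y) - (\<Sum>y\<in>UNIV. pmf (\<mu> x) y * f y)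
        \<le> \<alpha> / 2 * KL_act (\<pi>s x) (\<mu> x) + 1 / (4 * \<alpha>)"
      by (simp only: distrib_left)
    have K: "K (Suc n) x = KL_act (\<pi>s x) (\<mu> x) + (\<Sum>y\<in>UNIV. pmf (\<pi>s x) y * trans_expect M x y (K n))"
      unfolding K_def traj_value_Suc by (simp add: distrib_left sum.distrib KL_act_def)
    have U: "U \<pi> (Suc n) x = (\<Sum>y\<in>UNIV. pmf (\<pi> x) y * trans_expect M x y (U \<pi> n))" for \<pi>
      unfolding U_def traj_value_Suc by simp
    have "(\<Sum>y\<in>UNIV. pmf (\<pi>s x) y * trans_expect M x y (D n))
      = (\<Sum>y\<in>UNIV. pmf (\<pi>s x) y * trans_expect M x y (U \<pi>s n)) - (\<Sum>y\<in>UNIV. pmf (\<pi>s x) y * f y)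
        - \<alpha> / 2 * (\<Sum>y\<in>UNIV. pmf (\<pi>s x) y * trans_expect M x y (K n))"
      unfolding D_def[abs_def] trans_expect_diff trans_expect_mult f_def
      by (simp add: right_diff_distrib sum_subtractf sum_distrib_left mult.left_commute)
    moreover have "U \<mu> (Suc n) x = (\<Sum>y\<in>UNIV. pmf (\<mu> x) y * f y)"
      by (simp add: U f_def)
    ultimately show "D (Suc n) x \<le> 1 / (4 * \<alpha>) + (\<Sum>y\<in>UNIV. pmf (\<pi>s x) y * trans_expect M x y (D n))"
      using local_bound unfolding D_def[of "Suc n"] K U[of \<pi>s] by (simp add: algebra_simps)
  qed (use init_in in \<open>auto simp: D_def U_def K_def\<close>)
  moreover have "D (horizon M) (init_state M) = 1 / 2 - pref_policy M \<mu> \<pi>s - \<alpha> / 2 * KL_traj M \<pi>s \<mu>"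
    by (simp add: D_def U_def K_def KL_traj_eq[OF adm] pref_policy_self flip: pref_policy_eq)
  \<comment> \<open>The competitor is \<open>\<mu>\<close> itself, whose own divergence
    vanishes.\<close>
  moreover have "pref_policy M \<mu> \<pi>s \<le> 1 / 2 - \<alpha> * KL_traj M \<pi>s \<mu>"
    using nash_regularized_value(2)[OF nash, of \<mu>] by (simp add: admissible_def KL_traj_self)
  ultimately have "\<alpha> / 2 * KL_traj M \<pi>s \<mu> \<le> real (horizon M) * (1 / (4 * \<alpha>))" by simp
  then show ?thesis using \<alpha> by (simp add: field_simps power2_eq_square)
qed

text \<open>Under \<open>\<mu>\<close> no penalty accrues, so the mean of the Q-function at the
  initial state is the win probability in self-play. The resulting lower bound on \<open>B\<close>
  lets the rate absorb the initial divergence.\<close>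

lemma Q_average_ge_half:
  assumes \<nu>: "\<And>x. x \<in> nonterm_states M \<Longrightarrow> \<nu> x = \<mu> x"
    and Q: "\<And>y. Q_fun M \<mu> \<alpha> \<nu> \<nu> 1 (init_state M) y \<le> B"
  shows "1 / 2 \<le> B"
proof -
  have traj: "traj_pmf M \<nu> = traj_pmf M \<mu>" by (rule traj_pmf_cong) (rule \<nu>)
  have adm: "admissible M \<mu> \<nu>" by (simp add: admissible_def \<nu>)
  have H: "horizon M = Suc (horizon M - 1)" using horizon_ge_1 by simp
  have "1 / 2 = pref_policy M \<nu> \<nu> - \<alpha> * KL_traj M \<nu> \<mu>"
    using KL_traj_self[of \<mu>] by (simp add: pref_policy_self KL_traj_def traj)
  also have "\<dots> = traj_value M \<nu> (\<lambda>x y. - \<alpha> * KL_act (\<nu> x) (\<mu> x)) (\<lambda>z. pref_state_policy M z \<nu>)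
      (Suc (horizon M - 1)) (init_state M)"
    using regularized_value[OF adm] H by simp
  also have "\<dots> = (\<Sum>y\<in>UNIV. pmf (\<nu> (init_state M)) y * Q_fun M \<mu> \<alpha> \<nu> \<nu> 1 (init_state M) y)"
    using horizon_ge_1 by (subst traj_value_Suc) (simp add: Q_fun_eq)
  also have "\<dots> \<le> (\<Sum>y\<in>UNIV. pmf (\<nu> (init_state M)) y * B)"
    by (intro sum_mono mult_left_mono Q) auto
  also have "\<dots> = B"
    using sum_pmf_eq_1[of UNIV "\<nu> (init_state M)"] by (simp flip: sum_distrib_right)
  finally show ?thesis .
qed

section \<open>Invariants and descent of the MTPO iterates\<close>

lemma mtpo_update:
  assumes mtpo: "is_mtpo M \<mu> \<alpha> \<eta> \<pi>" and t: "t \<ge> 1" and h: "h \<in> {1..horizon M}" "x \<in> layer M h"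
    and supp: "\<And>y. pmf (\<mu> x) y > 0 \<Longrightarrow> pmf (\<pi> t x) y > 0"
  defines "w \<equiv> mirror_weight (\<mu> x) (\<pi> t x) (\<alpha> * \<eta> t) (\<eta> t) (Q_fun M \<mu> \<alpha> (\<pi> t) (\<pi> t) h x)"
  shows "pmf (\<pi> (t + 1) x) y = w y / (\<Sum>y\<in>UNIV. w y)"
  unfolding w_def
proof (rule mirror_argmax)
  show "is_arg_max (\<lambda>q. \<eta> t * (\<Sum>y\<in>UNIV. pmf q y * Q_fun M \<mu> \<alpha> (\<pi> t) (\<pi> t) h x y)
      - \<alpha> * \<eta> t * KL_act q (\<mu> x) - (1 - \<alpha> * \<eta> t) * KL_act q (\<pi> t x))
    (\<lambda>q. \<forall>y. pmf (\<mu> x) y = 0 \<longrightarrow> pmf q y = 0) (\<pi> (t + 1) x)"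
    using mtpo t h by (auto simp: is_mtpo_def mtpo_objective_def[abs_def])
qed (rule supp)

lemma mtpo_invariant:
  assumes mtpo: "is_mtpo M \<mu> \<alpha> \<eta> \<pi>"
    and \<eta>: "\<And>t. t \<ge> 1 \<Longrightarrow> 0 \<le> \<alpha> * \<eta> t \<and> \<alpha> * \<eta> t \<le> 1"
    and h: "h \<in> {1..horizon M}" "x \<in> layer M h"
    and Q: "\<And>t y. t \<ge> 1 \<Longrightarrow> \<bar>Q_fun M \<mu> \<alpha> (\<pi> t) (\<pi> t) h x y\<bar> \<le> B"
    and t: "t \<ge> 1"
  shows "(\<forall>y. pmf (\<pi> t x) y > 0 \<longleftrightarrow> pmf (\<mu> x) y > 0) \<and>
    (\<exists>c. \<forall>y. pmf (\<mu> x) y > 0 \<longrightarrow> \<bar>\<alpha> * ln (pmf (\<pi> t x) y / pmf (\<mu> x) y) - c\<bar> \<le> B)"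
  using t
proof (induction t rule: dec_induct)
  case base
  have "x \<in> nonterm_states M" using h by (auto intro: nonterm_statesI)
  then have "\<pi> 1 x = \<mu> x" using mtpo by (simp add: is_mtpo_def)
  \<comment> \<open>At the first iterate the log-ratio vanishes, so the constant 0 works once
    \<open>B\<close> is nonnegative.\<close>
  moreover have "B \<ge> 0" using order.trans[OF abs_ge_zero Q[of 1]] by simp
  ultimately show ?case by (auto intro!: exI[of _ 0])
next
  case (step t)
  then obtain c where supp: "\<And>y. pmf (\<pi> t x) y > 0 \<longleftrightarrow> pmf (\<mu> x) y > 0"
    and c: "\<And>y. pmf (\<mu> x) y > 0 \<Longrightarrow> \<bar>\<alpha> * ln (pmf (\<pi> t x) y / pmf (\<mu> x) y) - c\<bar> \<le> B"
    by blast
  note upd = mtpo_update[OF mtpo step.hyps(1) h supp[THEN iffD2]]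
  from mirror_step_invariant[OF supp[THEN iffD2] upd c Q[OF step.hyps(1)]] show ?case
    using \<eta>[OF step.hyps(1)] by simp
qed

lemma mtpo_admissible:
  assumes mtpo: "is_mtpo M \<mu> \<alpha> \<eta> \<pi>" and t: "t \<ge> 1"
  shows "admissible M \<mu> (\<pi> t)"
proof (cases "t = 1")
  case True
  with mtpo show ?thesis by (simp add: is_mtpo_def admissible_def)
next
  case False
  with t obtain t' where "t = t' + 1" "t' \<ge> 1" by (cases t) auto
  with mtpo show ?thesis
    by (auto simp: is_mtpo_def admissible_def is_arg_max_def elim!: nonterm_statesE)
qed

text \<open>A performance difference argument: \<open>mirror_step_descent\<close> holds at each
  state, and along trajectories of \<open>\<pi>s\<close> the Q-function differences telescope into a
  difference of regularised values against \<open>\<pi> t\<close>.\<close>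

lemma mtpo_descent:
  assumes mtpo: "is_mtpo M \<mu> \<alpha> \<eta> \<pi>" and nash: "is_nash M \<mu> \<alpha> \<pi>s"
    and \<eta>: "\<And>t. t \<ge> 1 \<Longrightarrow> 0 \<le> \<alpha> * \<eta> t \<and> \<alpha> * \<eta> t \<le> 1 \<and> 0 < \<eta> t"
    and Q: "\<And>t h x y. t \<ge> 1 \<Longrightarrow> h \<in> {1..horizon M} \<Longrightarrow> x \<in> layer M h \<Longrightarrow>
      \<bar>Q_fun M \<mu> \<alpha> (\<pi> t) (\<pi> t) h x y\<bar> \<le> B"
    and t: "t \<ge> 1"
  shows "KL_traj M \<pi>s (\<pi> (t + 1)) \<le> (1 - \<alpha> * \<eta> t) * KL_traj M \<pi>s (\<pi> t) + real (horizon M) * (2 * (\<eta> t)\<^sup>2 * B\<^sup>2)"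
proof -
  have adm: "admissible M \<mu> \<pi>s" using nash by (simp add: is_nash_def)
  have inv: "(\<forall>y. pmf (\<pi> t x) y > 0 \<longleftrightarrow> pmf (\<mu> x) y > 0) \<and>
    (\<exists>c. \<forall>y. pmf (\<mu> x) y > 0 \<longrightarrow> \<bar>\<alpha> * ln (pmf (\<pi> t x) y / pmf (\<mu> x) y) - c\<bar> \<le> B)"
    if "h \<in> {1..horizon M}" "x \<in> layer M h" "t \<ge> 1" for t h x
    by (rule mtpo_invariant[OF mtpo _ that(1,2) _ that(3)]) (use \<eta> Q that in auto)
  have adm_t: "admissible M (\<pi> t) \<pi>s" if "t \<ge> 1" for t
    unfolding admissible_def
  proof (intro ballI allI impI)
    fix x y assume x: "x \<in> nonterm_states M" and y: "pmf (\<pi> t x) y = 0"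
    from x obtain h where "h \<in> {1..horizon M}" "x \<in> layer M h" by (rule nonterm_statesE)
    with inv[of h x t] that have "pmf (\<pi> t x) y > 0 \<longleftrightarrow> pmf (\<mu> x) y > 0" by blast
    with y have "pmf (\<mu> x) y = 0" by (simp add: order.antisym not_less)
    with adm x show "pmf (\<pi>s x) y = 0" by (simp add: admissible_def)
  qed
  let ?g = "\<lambda>z. pref_state_policy M z (\<pi> t)"
  define K where "K t = traj_value M \<pi>s (\<lambda>x y. ln (pmf (\<pi>s x) y / pmf (\<pi> t x) y)) (\<lambda>_. 0)" for t
  define V where "V \<pi>' = traj_value M \<pi>' (\<lambda>x y. - \<alpha> * KL_act (\<pi>' x) (\<mu> x)) ?g" for \<pi>'
  \<comment> \<open>Subtracting the value difference leaves a recursion whose only error per step is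
    the second-order term: the values at the next layer reappear inside \<open>D n\<close>.\<close>
  define D where "D n x = K (t + 1) n x - (1 - \<alpha> * \<eta> t) * K t n x - \<eta> t * (V (\<pi> t) n x - V \<pi>s n x)" for n x
  have "D (horizon M) (init_state M) \<le> real (horizon M) * (2 * (\<eta> t)\<^sup>2 * B\<^sup>2)"
  proof (rule backward_bound[where h = 1 and \<pi> = \<pi>s])
    fix h n x assume h': "1 \<le> h" "h + n = horizon M" "x \<in> layer M h"
    then have h: "h \<in> {1..horizon M}" "x \<in> layer M h" and n: "horizon M - h = n" by auto
    have x: "x \<in> nonterm_states M" using h by (auto intro: nonterm_statesI)
    have ac: "pmf (\<mu> x) y > 0" if "pmf (\<pi>s x) y > 0" for y
      using that adm x by (fastforce simp: admissible_def order_less_le)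
    define S where "S f = (\<Sum>y\<in>UNIV. pmf (\<pi>s x) y * trans_expect M x y f)" for f
    define q where "q y = Q_fun M \<mu> \<alpha> (\<pi> t) (\<pi> t) h x y" for y
    have q: "q y = - \<alpha> * KL_act (\<pi> t x) (\<mu> x) + trans_expect M x y (V (\<pi> t) n)" for y
      unfolding q_def Q_fun_eq[OF h(1)] V_def n ..
    have sum1: "(\<Sum>y\<in>UNIV. pmf p y) = 1" for p :: "'y pmf" by (rule sum_pmf_eq_1) auto
    obtain c where supp: "\<And>y. pmf (\<pi> t x) y > 0 \<longleftrightarrow> pmf (\<mu> x) y > 0"
      and c: "\<And>y. pmf (\<mu> x) y > 0 \<Longrightarrow> \<bar>\<alpha> * ln (pmf (\<pi> t x) y / pmf (\<mu> x) y) - c\<bar> \<le> B"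
      using inv[OF h t] by blast
    note upd = mtpo_update[OF mtpo t h supp[THEN iffD2]]
    have local_bound: "KL_act (\<pi>s x) (\<pi> (t + 1) x) \<le> (1 - \<alpha> * \<eta> t) * KL_act (\<pi>s x) (\<pi> t x)
      + \<eta> t * ((\<Sum>y\<in>UNIV. pmf (\<pi> t x) y * q y) - (\<Sum>y\<in>UNIV. pmf (\<pi>s x) y * q y)
        + \<alpha> * KL_act (\<pi>s x) (\<mu> x) - \<alpha> * KL_act (\<pi> t x) (\<mu> x)) + 2 * (\<eta> t)\<^sup>2 * B\<^sup>2"
      unfolding q_def using \<eta>[OF t]
      by (intro mirror_step_descent[OF supp ac _ c Q[OF t h]]) (simp_all only: upd)
    have K: "K t (Suc n) x = KL_act (\<pi>s x) (\<pi> t x) + S (K t n)" for t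
      unfolding K_def traj_value_Suc S_def by (simp add: distrib_left sum.distrib KL_act_def)
    have Vt: "V (\<pi> t) (Suc n) x = (\<Sum>y\<in>UNIV. pmf (\<pi> t x) y * q y)"
      unfolding q V_def traj_value_Suc ..
    have avg: "(\<Sum>y\<in>UNIV. pmf (\<pi>s x) y * (k + trans_expect M x y f)) = k + S f" for k f
      by (simp add: S_def distrib_left sum.distrib sum1 flip: sum_distrib_right)
    have Vs: "V \<pi>s (Suc n) x = - \<alpha> * KL_act (\<pi>s x) (\<mu> x) + S (V \<pi>s n)"
      unfolding V_def traj_value_Suc avg ..
    \<comment> \<open>This average keeps the penalty of \<open>\<pi> t\<close>, which cancels
      against the last divergence in the local bound.\<close>
    have qs: "(\<Sum>y\<in>UNIV. pmf (\<pi>s x) y * q y) = - \<alpha> * KL_act (\<pi> t x) (\<mu> x) + S (V (\<pi> t) n)"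
      unfolding q avg ..
    have SD: "S (D n) = S (K (t + 1) n) - (1 - \<alpha> * \<eta> t) * S (K t n) - \<eta> t * (S (V (\<pi> t) n) - S (V \<pi>s n))"
      unfolding D_def[abs_def] S_def trans_expect_diff trans_expect_mult
      by (simp add: right_diff_distrib left_diff_distrib sum_subtractf sum_distrib_left mult.left_commute)
    show "D (Suc n) x \<le> 2 * (\<eta> t)\<^sup>2 * B\<^sup>2 + (\<Sum>y\<in>UNIV. pmf (\<pi>s x) y * trans_expect M x y (D n))"
      using local_bound unfolding S_def[symmetric] SD qs D_def[of "Suc n"] K Vt Vs
      by (simp add: algebra_simps)
  qed (use init_in in \<open>auto simp: D_def V_def K_def\<close>)
  \<comment> \<open>Equilibrium enters here: against \<open>\<pi> t\<close>, the policy
    \<open>\<pi>s\<close> does at least as well as \<open>\<pi> t\<close> itself.\<close>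
  moreover have "V (\<pi> t) (horizon M) (init_state M) \<le> V \<pi>s (horizon M) (init_state M)"
    using nash_regularized_value(1)[OF nash mtpo_admissible[OF mtpo t]]
    unfolding V_def by (simp only: regularized_value[OF adm] regularized_value[OF mtpo_admissible[OF mtpo t]] pref_policy_self)
  then have "\<eta> t * (V (\<pi> t) (horizon M) (init_state M) - V \<pi>s (horizon M) (init_state M)) \<le> 0"
    using \<eta>[OF t] by (simp add: mult_le_0_iff)
  moreover have "K t (horizon M) (init_state M) = KL_traj M \<pi>s (\<pi> t)" if "t \<ge> 1" for t
    unfolding K_def by (rule KL_traj_eq[OF adm_t[OF that], symmetric])
  ultimately show ?thesis using t by (simp add: D_def)
qed

section \<open>Bounds on the Q-functions through the smallest reference probability\<close>

lemma min_prob_bounds: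
  shows "0 < min_prob M \<mu>" "min_prob M \<mu> \<le> 1"
    and "x \<in> nonterm_states M \<Longrightarrow> pmf (\<mu> x) y > 0 \<Longrightarrow> min_prob M \<mu> \<le> pmf (\<mu> x) y"
proof -
  let ?A = "{pmf (\<mu> x) y | x y. x \<in> nonterm_states M \<and> pmf (\<mu> x) y > 0}"
  have "?A \<subseteq> (\<lambda>(x, y). pmf (\<mu> x) y) ` UNIV" by auto
  then have fin: "finite ?A" by (rule finite_subset) simp
  have "init_state M \<in> nonterm_states M"
    using init_in horizon_ge_1 by (auto intro: nonterm_statesI)
  moreover obtain y0 where "y0 \<in> set_pmf (\<mu> (init_state M))"
    using set_pmf_not_empty by fast
  ultimately have "pmf (\<mu> (init_state M)) y0 \<in> ?A" using pmf_positive by fast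
  then have "?A \<noteq> {}" by blast
  then have "min_prob M \<mu> \<in> ?A" unfolding min_prob_def by (rule Min_in[OF fin])
  then show "0 < min_prob M \<mu>" "min_prob M \<mu> \<le> 1" by (auto simp: pmf_le_1)
  show "min_prob M \<mu> \<le> pmf (\<mu> x) y" if "x \<in> nonterm_states M" "pmf (\<mu> x) y > 0"
    unfolding min_prob_def by (rule Min_le[OF fin]) (use that in auto)
qed

text \<open>Numerators of the ratios are at most 1, and admissibility keeps the relevant
  denominators above \<open>min_prob M \<mu>\<close>.\<close>

lemma KL_act_range:
  assumes adm: "admissible M \<mu> \<pi>" and x: "x \<in> nonterm_states M"
  shows "KL_act (\<pi> x) (\<mu> x) \<in> {0..ln (1 / min_prob M \<mu>)}"
proof -
  have ac: "pmf (\<mu> x) y > 0" if "pmf (\<pi> x) y > 0" for y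
    using that adm x by (fastforce simp: admissible_def order_less_le)
  have "KL_act (\<pi> x) (\<mu> x) \<le> (\<Sum>y\<in>UNIV. pmf (\<pi> x) y * ln (1 / min_prob M \<mu>))"
    unfolding KL_act_def
  proof (rule sum_mono)
    fix y
    show "pmf (\<pi> x) y * ln (pmf (\<pi> x) y / pmf (\<mu> x) y) \<le> pmf (\<pi> x) y * ln (1 / min_prob M \<mu>)"
    proof (cases "pmf (\<pi> x) y = 0")
      case False
      then have pos: "pmf (\<pi> x) y > 0" "pmf (\<mu> x) y > 0" using ac by (auto simp: order_less_le)
      have "pmf (\<pi> x) y / pmf (\<mu> x) y \<le> 1 / min_prob M \<mu>"
        using pos min_prob_bounds(1) min_prob_bounds(3)[where \<mu> = \<mu>, OF x pos(2)] by (intro frac_le) (auto simp: pmf_le_1)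
      then have "ln (pmf (\<pi> x) y / pmf (\<mu> x) y) \<le> ln (1 / min_prob M \<mu>)"
        using pos min_prob_bounds(1) by (subst ln_le_cancel_iff) auto
      then show ?thesis by (intro mult_left_mono) auto
    qed simp
  qed
  also have "\<dots> = ln (1 / min_prob M \<mu>)"
    using sum_pmf_eq_1[of UNIV "\<pi> x"] by (simp flip: sum_distrib_right)
  finally show ?thesis using KL_act_nonneg[of "\<pi> x" "\<mu> x"] ac by simp
qed

text \<open>Win probabilities are at most 1 and penalties only subtract, hence the upper end. From
  layer \<open>h\<close> on there are \<open>horizon M - h + 1\<close> penalties, at most
  \<open>horizon M\<close>, hence the lower end.\<close>

lemma Q_fun_range:
  assumes adm: "admissible M \<mu> \<pi>" and \<alpha>: "\<alpha> \<ge> 0" and h: "h \<in> {1..horizon M}" "x \<in> layer M h"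
  shows "Q_fun M \<mu> \<alpha> \<pi> \<pi>' h x y \<in> {- \<alpha> * real (horizon M) * ln (1 / min_prob M \<mu>)..1}"
proof -
  define L where "L = ln (1 / min_prob M \<mu>)"
  have L: "L \<ge> 0" using min_prob_bounds(1,2)[of \<mu>] by (simp add: L_def)
  have KL: "- \<alpha> * KL_act (\<pi> x) (\<mu> x) \<in> {- \<alpha> * L..0}" if "x \<in> nonterm_states M" for x
    using KL_act_range[OF adm that] \<alpha> by (auto simp: L_def mult_left_mono)
  let ?V = "traj_value M \<pi> (\<lambda>x y. - \<alpha> * KL_act (\<pi> x) (\<mu> x)) (\<lambda>z. pref_state_policy M z \<pi>') (horizon M - h)"
  have V: "?V x' \<in> {real (horizon M - h) * (- \<alpha> * L)..1}" if "x' \<in> set_pmf (transition M x y)" for x'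
  proof -
    have x': "x' \<in> layer M (h + 1)" using that trans_layer[OF h] by auto
    have "?V x' \<le> 1 + real (horizon M - h) * 0"
      by (rule traj_value_le[of _ _ _ _ "h + 1"]) (use x' h KL pref_state_policy_range in fastforce)+
    moreover have "0 + real (horizon M - h) * (- \<alpha> * L) \<le> ?V x'"
      by (rule traj_value_ge[of _ _ _ _ "h + 1"]) (use x' h KL pref_state_policy_range in fastforce)+
    ultimately show ?thesis by simp
  qed
  have "trans_expect M x y ?V \<le> trans_expect M x y (\<lambda>_. 1)"
    by (rule trans_expect_mono) (use V in force)
  moreover have "trans_expect M x y (\<lambda>_. real (horizon M - h) * (- \<alpha> * L)) \<le> trans_expect M x y ?V"
    by (rule trans_expect_mono) (use V in force)
  moreover have "- \<alpha> * KL_act (\<pi> x) (\<mu> x) \<in> {- \<alpha> * L..0}"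
    using h by (intro KL nonterm_statesI[of h]) auto
  moreover have "(real (horizon M - h) + 1) * (\<alpha> * L) \<le> real (horizon M) * (\<alpha> * L)"
    using h \<alpha> L by (intro mult_right_mono) auto
  ultimately show ?thesis
    unfolding Q_fun_eq[OF h(1)] L_def[symmetric] trans_expect_const by (auto simp: algebra_simps)
qed

end

theorem theorem4p2:
  fixes M :: "('x::finite, 'y::finite) pref_mdp"
    and \<mu> :: "('x, 'y) policy" and \<alpha> :: real
    and \<pi> :: "nat \<Rightarrow> ('x, 'y) policy"
  assumes "pref_mdp M" and "\<alpha> > 0"
    and "is_mtpo M \<mu> \<alpha> (\<lambda>t. 2 / (\<alpha> * (real t + 2))) \<pi>"
  shows "(\<forall>\<pi>s QQ. is_nash M \<mu> \<alpha> \<pi>s \<longrightarrow>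
            (\<forall>t\<ge>1. \<forall>h\<in>{1..horizon M}. \<forall>x\<in>layer M h. \<forall>y.
               \<bar>Q_fun M \<mu> \<alpha> (\<pi> t) (\<pi> t) h x y\<bar> \<le> QQ) \<longrightarrow>
            (\<forall>t\<ge>1. KL_traj M \<pi>s (\<pi> t) \<le> 32 * real (horizon M) * QQ\<^sup>2 / (\<alpha>\<^sup>2 * (real t + 1))))
       \<and> (\<forall>t\<ge>1. \<forall>h\<in>{1..horizon M}. \<forall>x\<in>layer M h. \<forall>y.
            \<bar>Q_fun M \<mu> \<alpha> (\<pi> t) (\<pi> t) h x y\<bar>
              \<le> max (4 * \<alpha> * real (horizon M) * ln (1 / min_prob M \<mu>)) 1)"
proof -
  interpret pref_mdp M by fact
  note \<alpha> = \<open>\<alpha> > 0\<close> and mtpo = assms(3)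
  have "KL_traj M \<pi>s (\<pi> t) \<le> 32 * real (horizon M) * QQ\<^sup>2 / (\<alpha>\<^sup>2 * (real t + 1))"
    if nash: "is_nash M \<mu> \<alpha> \<pi>s"
      and Q: "\<forall>t\<ge>1. \<forall>h\<in>{1..horizon M}. \<forall>x\<in>layer M h. \<forall>y. \<bar>Q_fun M \<mu> \<alpha> (\<pi> t) (\<pi> t) h x y\<bar> \<le> QQ"
      and t: "t \<ge> 1" for \<pi>s QQ t
  proof -
    define K where "K = real (horizon M) * QQ\<^sup>2 / \<alpha>\<^sup>2"
    have "KL_traj M \<pi>s (\<pi> t) \<le> 32 * K / (real t + 1)"
      using t
    proof (induction t rule: dec_induct)
      case base
      have \<pi>1: "\<pi> 1 x = \<mu> x" if "x \<in> nonterm_states M" for x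
        using mtpo that by (simp add: is_mtpo_def)
      have "Q_fun M \<mu> \<alpha> (\<pi> 1) (\<pi> 1) 1 (init_state M) y \<le> QQ" for y
        using Q init_in horizon_ge_1 by (auto simp: abs_le_iff)
      then have "1 / 2 \<le> QQ" using \<pi>1 by (rule Q_average_ge_half[rotated])
      then have "(1 / 2)\<^sup>2 \<le> QQ\<^sup>2" by (intro power_mono) auto
      \<comment> \<open>The target at \<open>t = 1\<close> is \<open>16 * K\<close>, and the initial
        divergence bound stays below it because \<open>QQ\<close> is at least
        \<open>1 / 2\<close>.\<close>
      then have Q2: "1 \<le> 4 * QQ\<^sup>2" by (simp add: power2_eq_square)
      have "KL_traj M \<pi>s (\<pi> 1) = KL_traj M \<pi>s \<mu>"
        unfolding KL_traj_def using traj_pmf_cong[of "\<pi> 1" \<mu>] \<pi>1 by simp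
      also have "\<dots> \<le> real (horizon M) / (2 * \<alpha>\<^sup>2) * 1"
        using nash_KL_reference[OF nash \<alpha>] by simp
      also have "\<dots> \<le> real (horizon M) / (2 * \<alpha>\<^sup>2) * (32 * QQ\<^sup>2)"
        using Q2 by (intro mult_left_mono) auto
      finally show ?case by (simp add: K_def)
    next
      case (step t)
      define \<eta> where "\<eta> t = 2 / (\<alpha> * (real t + 2))" for t
      have K: "K \<ge> 0" by (simp add: K_def)
      have "KL_traj M \<pi>s (\<pi> (t + 1)) \<le> (1 - \<alpha> * \<eta> t) * KL_traj M \<pi>s (\<pi> t)
          + real (horizon M) * (2 * (\<eta> t)\<^sup>2 * QQ\<^sup>2)"
      proof (rule mtpo_descent[OF _ nash _ _ step.hyps(1)])
        show "is_mtpo M \<mu> \<alpha> \<eta> \<pi>" using mtpo by (simp add: \<eta>_def[abs_def])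
        show "0 \<le> \<alpha> * \<eta> t \<and> \<alpha> * \<eta> t \<le> 1 \<and> 0 < \<eta> t" for t
          using \<alpha> by (simp add: \<eta>_def)
      qed (use Q in auto)
      also have "1 - \<alpha> * \<eta> t = real t / (real t + 2)"
      proof -
        have "\<alpha> * \<eta> t = 2 / (real t + 2)" using \<alpha> by (simp add: \<eta>_def)
        then show ?thesis by (simp add: field_simps)
      qed
      also have "real (horizon M) * (2 * (\<eta> t)\<^sup>2 * QQ\<^sup>2) = 8 * K / (real t + 2)\<^sup>2"
        by (simp add: \<eta>_def K_def power_divide power_mult_distrib)
      also have "real t / (real t + 2) * KL_traj M \<pi>s (\<pi> t) \<le> real t / (real t + 2) * (32 * K / (real t + 1))"
        by (intro mult_left_mono step.IH) auto
      \<comment> \<open>Over the common denominator \<open>(t + 1) * (t + 2)\<close> both terms now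
        have the constant \<open>32 * K\<close>; the numerators \<open>t\<close> and
        \<open>1\<close> add up to \<open>t + 1\<close>, which cancels.\<close>
      also have "8 * K / (real t + 2)\<^sup>2 \<le> 32 * K / ((real t + 1) * (real t + 2))"
        using K by (intro frac_le) (auto simp: power2_eq_square intro!: mult_mono)
      also have "real t / (real t + 2) * (32 * K / (real t + 1)) + 32 * K / ((real t + 1) * (real t + 2))
          = 32 * K / (real t + 2)"
        by (simp add: divide_simps) (simp add: algebra_simps)
      finally show ?case by (simp add: add.commute)
    qed
    then show ?thesis by (simp add: K_def)
  qed
  moreover have "\<bar>Q_fun M \<mu> \<alpha> (\<pi> t) (\<pi> t) h x y\<bar> \<le> max (4 * \<alpha> * real (horizon M) * ln (1 / min_prob M \<mu>)) 1"
    if "t \<ge> 1" "h \<in> {1..horizon M}" "x \<in> layer M h" for t h x y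
  proof -
    \<comment> \<open>Being nonnegative, this quantity is at most its fourfold, so both ends of the
      range in \<open>Q_fun_range\<close> obey the claimed bound.\<close>
    have "\<alpha> * real (horizon M) * ln (1 / min_prob M \<mu>) \<ge> 0"
      using \<alpha> min_prob_bounds(1,2)[of \<mu>] by (intro mult_nonneg_nonneg) auto
    then show ?thesis
      using Q_fun_range[OF mtpo_admissible[OF mtpo that(1)] _ that(2,3), of \<alpha> "\<pi> t" y] \<alpha> by (auto simp: abs_le_iff)
  qed
  ultimately show ?thesis by blast
qed

end
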